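(* $\mathsf{WKL}$ admits preservation of the arithmetic hierarchy. That is, for every set $Z$ and every $Z$-computable infinite subtree $T \subseteq 2^{<\omega}$, there exists an infinite path $G \in [T]$ such that $G$ preserves the arithmetic hierarchy relative to $Z$.
   Context: For a set $X$ and $n>0$, $\Sigma^X_n$, $\Pi^X_n$, $\Delta^X_{n+1}$ denote the classes of subsets of $\omega$ that are $\Sigma^0_n$, $\Pi^0_n$, $\Delta^0_{n+1}$ relative to $X$. A set is properly $\Sigma^X_n$ if it is $\Sigma^X_n$ but not $\Pi^X_n$; properly $\Pi^X_n$ if it is $\Pi^X_n$ but not $\Sigma^X_n$; properly $\Delta^X_{n+1}$ if it is $\Delta^X_{n+1}$ but neither $\Sigma^X_n$ nor $\Pi^X_n$. For $\Xi$ among $\Delta^0_{n+1},\Pi^0_n,\Sigma^0_n$ ($n>0$), a set $Y$ preserves $\Xi$-definitions relative to $X$ if every set that is properly $\Xi$ relative to $X$ is properly $\Xi$ relative to $X\oplus Y$. $Y$ preserves the arithmetic hierarchy relative to $X$ if $Y$ preserves $\Xi$-definitions relative to $X$ for every such $\Xi$ and every $n>0$. $\mathsf{WKL}$ is the statement that every infinite subtree of $2^{<\omega}$ has an infinite path. *)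

theory Defs
  imports Main "HOL-Library.Sublist"
begin

section \<open>Computability relative to a set\<close>

text \<open>
  Kleene's partial recursive functions that may query a set \<open>X\<close>. Programs carry no arity;
  they are run on argument lists, and where no rule applies the result is undefined.
\<close>

datatype prog =
    Zero
  | Succ
  | Query
  | Proj nat
  | Comp prog "prog list"
  | PrimRec prog prog
  | Mu prog

inductive computes :: "nat set \<Rightarrow> prog \<Rightarrow> nat list \<Rightarrow> nat \<Rightarrow> bool" for X :: "nat set" where
  zero: "computes X Zero xs 0"
| succ: "computes X Succ [x] (Suc x)"
| query: "computes X Query [x] (of_bool (x \<in> X))"
| proj: "i < length xs \<Longrightarrow> computes X (Proj i) xs (xs ! i)"
| comp: "list_all2 (\<lambda>g y. computes X g xs y) gs ys \<Longrightarrow> computes X f ys z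
    \<Longrightarrow> computes X (Comp f gs) xs z"
| primrec_0: "computes X f xs y \<Longrightarrow> computes X (PrimRec f g) (0 # xs) y"
| primrec_Suc: "computes X (PrimRec f g) (n # xs) r \<Longrightarrow> computes X g (n # r # xs) y
    \<Longrightarrow> computes X (PrimRec f g) (Suc n # xs) y"
| mu: "computes X f (n # xs) 0 \<Longrightarrow> (\<And>m. m < n \<Longrightarrow> \<exists>y. y \<noteq> 0 \<and> computes X f (m # xs) y)
    \<Longrightarrow> computes X (Mu f) xs n"

definition computable_rel :: "nat set \<Rightarrow> nat \<Rightarrow> (nat list \<Rightarrow> bool) \<Rightarrow> bool" where
  "computable_rel X k R \<longleftrightarrow>
     (\<exists>p. \<forall>xs. length xs = k \<longrightarrow> computes X p xs (of_bool (R xs)))"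

definition computable_set :: "nat set \<Rightarrow> nat set \<Rightarrow> bool" where
  "computable_set X A \<longleftrightarrow> (\<exists>p. \<forall>x. computes X p [x] (of_bool (x \<in> A)))"

definition join :: "nat set \<Rightarrow> nat set \<Rightarrow> nat set"  (infixl "\<oplus>" 65) where
  "X \<oplus> Y = {2 * x | x. x \<in> X} \<union> {2 * y + 1 | y. y \<in> Y}"


section \<open>The arithmetic hierarchy relative to a set\<close>

text \<open>
  \<open>exists_alt n R\<close> is \<open>\<exists>y\<^sub>1. \<forall>y\<^sub>2. \<exists>y\<^sub>3. \<dots> R [y\<^sub>1, \<dots>, y\<^sub>n]\<close>, and \<open>forall_alt n R\<close> is its dual,
  with leading quantifier \<open>\<forall>\<close>.
\<close>

fun exists_alt :: "nat \<Rightarrow> (nat list \<Rightarrow> bool) \<Rightarrow> bool"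
and forall_alt :: "nat \<Rightarrow> (nat list \<Rightarrow> bool) \<Rightarrow> bool" where
  "exists_alt 0 R \<longleftrightarrow> R []"
| "exists_alt (Suc n) R \<longleftrightarrow> (\<exists>y. forall_alt n (\<lambda>ys. R (y # ys)))"
| "forall_alt 0 R \<longleftrightarrow> R []"
| "forall_alt (Suc n) R \<longleftrightarrow> (\<forall>y. exists_alt n (\<lambda>ys. R (y # ys)))"

definition sigma_class :: "nat \<Rightarrow> nat set \<Rightarrow> nat set set" where
  "sigma_class n X =
     {A. \<exists>R. computable_rel X (Suc n) R \<and> (\<forall>x. x \<in> A \<longleftrightarrow> exists_alt n (\<lambda>ys. R (x # ys)))}"

definition pi_class :: "nat \<Rightarrow> nat set \<Rightarrow> nat set set" where
  "pi_class n X =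
     {A. \<exists>R. computable_rel X (Suc n) R \<and> (\<forall>x. x \<in> A \<longleftrightarrow> forall_alt n (\<lambda>ys. R (x # ys)))}"

definition delta_class :: "nat \<Rightarrow> nat set \<Rightarrow> nat set set" where
  "delta_class n X = sigma_class n X \<inter> pi_class n X"

definition properly_sigma :: "nat \<Rightarrow> nat set \<Rightarrow> nat set set" where
  "properly_sigma n X = sigma_class n X - pi_class n X"

definition properly_pi :: "nat \<Rightarrow> nat set \<Rightarrow> nat set set" where
  "properly_pi n X = pi_class n X - sigma_class n X"

text \<open>The index is that of the \<open>\<Delta>\<close> class itself, so this is meant for \<open>n \<ge> 2\<close>.\<close>

definition properly_delta :: "nat \<Rightarrow> nat set \<Rightarrow> nat set set" where
  "properly_delta n X = delta_class n X - (sigma_class (n - 1) X \<union> pi_class (n - 1) X)"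

text \<open>Here \<open>\<Xi>\<close> is one of the operators \<open>properly_sigma n\<close>, \<open>properly_pi n\<close>, \<open>properly_delta n\<close>.
  Preservation is by \<open>Y\<close>, relative to \<open>X\<close>.\<close>

definition preserves_definitions ::
    "(nat set \<Rightarrow> nat set set) \<Rightarrow> nat set \<Rightarrow> nat set \<Rightarrow> bool" where
  "preserves_definitions \<Xi> X Y \<longleftrightarrow> (\<forall>A. A \<in> \<Xi> X \<longrightarrow> A \<in> \<Xi> (X \<oplus> Y))"

definition preserves_arithmetic_hierarchy :: "nat set \<Rightarrow> nat set \<Rightarrow> bool" where
  "preserves_arithmetic_hierarchy X Y \<longleftrightarrow>
     (\<forall>n>0. preserves_definitions (properly_sigma n) X Y
          \<and> preserves_definitions (properly_pi n) X Y
          \<and> preserves_definitions (properly_delta (Suc n)) X Y)"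


section \<open>Binary trees\<close>

definition binary_tree :: "bool list set \<Rightarrow> bool" where
  "binary_tree T \<longleftrightarrow> (\<forall>\<sigma>\<in>T. \<forall>\<tau>. prefix \<tau> \<sigma> \<longrightarrow> \<tau> \<in> T)"

text \<open>
  The bijection between binary strings and natural numbers that lists the strings by length and
  then lexicographically: the code of \<open>\<sigma> @ [b]\<close> is \<open>2 * c + 1 + b\<close> where \<open>c\<close> is the code of \<open>\<sigma>\<close>.
\<close>

definition string_code :: "bool list \<Rightarrow> nat" where
  "string_code \<sigma> = foldl (\<lambda>c b. 2 * c + 1 + of_bool b) 0 \<sigma>"

definition computable_tree :: "nat set \<Rightarrow> bool list set \<Rightarrow> bool" where
  "computable_tree X T \<longleftrightarrow> computable_set X (string_code ` T)"

text \<open>Infinite paths are elements of Cantor space, identified with sets of natural numbers.\<close>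

definition paths :: "bool list set \<Rightarrow> nat set set" where
  "paths T = {G. \<forall>n. map (\<lambda>i. i \<in> G) [0..<n] \<in> T}"

end

theory Submission
  imports Defs Complex_Main "HOL-Library.Nat_Bijection" "HOL-Library.Countable"
begin

text \<open>
  The path \<open>G\<close> is generic for forcing with nonempty \<open>\<Pi>\<^sup>Z\<^sub>1\<close> subclasses of \<open>[T]\<close>. Fix a condition and a
  \<open>\<Sigma>\<^sub>n\<close> formula about \<open>Z \<oplus> G\<close>. The question whether the formula can be forced (for \<open>n = 1\<close>: whether
  it holds on the whole class, which by compactness is a \<open>\<Sigma>\<^sup>Z\<^sub>1\<close> question) is itself \<open>\<Sigma>\<^sup>Z\<^sub>n\<close>, and
  whatever the answer, some extension forces the formula accordingly. So if \<open>A\<close> is not \<open>\<Sigma>\<^sup>Z\<^sub>n\<close>, the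
  set of \<open>m\<close> with a positive answer differs from \<open>A\<close> at some \<open>m\<close>, and an extension makes the
  \<open>\<Sigma>\<^sub>n\<close> set of \<open>Z \<oplus> G\<close> differ from \<open>A\<close> there. As only countably many \<open>A\<close> are arithmetical in \<open>Z\<close>, a
  sufficiently generic \<open>G\<close> meets all these requirements at once.
\<close>

section \<open>Closure properties of relative computability\<close>

definition computable_fun :: "nat set \<Rightarrow> nat \<Rightarrow> (nat list \<Rightarrow> nat) \<Rightarrow> bool" where
  "computable_fun X k f \<longleftrightarrow> (\<exists>p. \<forall>xs. length xs = k \<longrightarrow> computes X p xs (f xs))"

lemma computable_funI:
  assumes "\<And>xs. length xs = k \<Longrightarrow> computes X p xs (f xs)"
  shows "computable_fun X k f"
  using assms unfolding computable_fun_def by blast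

lemma computable_fun_cong:
  assumes "computable_fun X k f" "\<And>xs. length xs = k \<Longrightarrow> f xs = g xs"
  shows "computable_fun X k g"
  using assms unfolding computable_fun_def by metis

lemma computable_fun_comp:
  assumes "computable_fun X (length gs) f" "\<And>g. g \<in> set gs \<Longrightarrow> computable_fun X k g"
  shows "computable_fun X k (\<lambda>xs. f (map (\<lambda>g. g xs) gs))"
proof -
  obtain p where p: "\<And>ys. length ys = length gs \<Longrightarrow> computes X p ys (f ys)"
    using assms(1) unfolding computable_fun_def by blast
  obtain q where q: "\<And>g xs. g \<in> set gs \<Longrightarrow> length xs = k \<Longrightarrow> computes X (q g) xs (g xs)"
    using assms(2) unfolding computable_fun_def by metis
  show ?thesis
  proof (rule computable_funI[where p = "Comp p (map q gs)"])
    fix xs :: "nat list" assume "length xs = k"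
    then have "list_all2 (\<lambda>g y. computes X g xs y) (map q gs) (map (\<lambda>g. g xs) gs)"
      by (auto simp: list_all2_conv_all_nth q)
    then show "computes X (Comp p (map q gs)) xs (f (map (\<lambda>g. g xs) gs))"
      by (rule computes.comp) (simp add: p)
  qed
qed

lemma computable_fun_proj: "i < k \<Longrightarrow> computable_fun X k (\<lambda>xs. xs ! i)"
  by (rule computable_funI[where p = "Proj i"]) (auto intro: computes.proj)

lemma computable_fun_Suc:
  assumes "computable_fun X k f"
  shows "computable_fun X k (\<lambda>xs. Suc (f xs))"
proof -
  have "computable_fun X 1 (\<lambda>xs. Suc (xs ! 0))"
    by (rule computable_funI[where p = Succ]) (auto simp: length_Suc_conv intro: computes.succ)
  then show ?thesis
    using computable_fun_comp[where gs = "[f]" and f = "\<lambda>xs. Suc (xs ! 0)"] assms by simp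
qed

lemma computable_fun_const: "computable_fun X k (\<lambda>xs. c)"
proof (induction c)
  case 0
  show ?case by (rule computable_funI[where p = Zero]) (rule computes.zero)
qed (rule computable_fun_Suc)

lemma computable_fun_drop:
  assumes "computable_fun X k f"
  shows "computable_fun X (j + k) (\<lambda>xs. f (drop j xs))"
proof -
  have "computable_fun X (j + k)
      (\<lambda>xs. f (map (\<lambda>g. g xs) (map (\<lambda>i xs. xs ! (j + i)) [0..<k])))"
    using assms by (intro computable_fun_comp) (auto intro: computable_fun_proj)
  then show ?thesis
    by (rule computable_fun_cong) (auto intro!: arg_cong[where f = f] nth_equalityI simp: add.commute)
qed

lemma computable_fun_rec_nat:
  assumes a: "computable_fun X k a"
    and b: "computable_fun X (2 + k) (\<lambda>zs. b (drop 2 zs) (zs ! 0) (zs ! 1))"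
    and n: "computable_fun X k n"
  shows "computable_fun X k (\<lambda>xs. rec_nat (a xs) (b xs) (n xs))"
proof -
  obtain p where p: "\<And>xs. length xs = k \<Longrightarrow> computes X p xs (a xs)"
    using a unfolding computable_fun_def by blast
  obtain q where q: "\<And>xs. length xs = 2 + k \<Longrightarrow> computes X q xs (b (drop 2 xs) (xs ! 0) (xs ! 1))"
    using b unfolding computable_fun_def by blast
  have rec: "computes X (PrimRec p q) (m # xs) (rec_nat (a xs) (b xs) m)"
    if "length xs = k" for m xs
  proof (induction m)
    case 0
    show ?case using p[OF that] by (simp add: computes.primrec_0)
  next
    case (Suc m)
    show ?case
      using computes.primrec_Suc[OF Suc] q[of "m # rec_nat (a xs) (b xs) m # xs"] that by simp
  qed
  have "computable_fun X (length (n # map (\<lambda>i xs. xs ! i) [0..<k]))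
      (\<lambda>zs. rec_nat (a (tl zs)) (b (tl zs)) (hd zs))"
    by (rule computable_funI[where p = "PrimRec p q"]) (auto simp: length_Suc_conv rec)
  then have "computable_fun X k (\<lambda>xs. rec_nat
      (a (tl (map (\<lambda>g. g xs) (n # map (\<lambda>i xs. xs ! i) [0..<k]))))
      (b (tl (map (\<lambda>g. g xs) (n # map (\<lambda>i xs. xs ! i) [0..<k]))))
      (hd (map (\<lambda>g. g xs) (n # map (\<lambda>i xs. xs ! i) [0..<k]))))"
    by (rule computable_fun_comp) (use n in \<open>auto intro: computable_fun_proj\<close>)
  then show ?thesis
    by (rule computable_fun_cong) (auto simp: comp_def map_nth)
qed

lemma computable_fun_Least:
  assumes f: "computable_fun X (1 + k) (\<lambda>zs. f (drop 1 zs) (zs ! 0))"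
    and ex: "\<And>xs. length xs = k \<Longrightarrow> \<exists>n. f xs n = (0 :: nat)"
  shows "computable_fun X k (\<lambda>xs. LEAST n. f xs n = 0)"
proof -
  obtain p where p: "\<And>xs. length xs = 1 + k \<Longrightarrow> computes X p xs (f (drop 1 xs) (xs ! 0))"
    using f unfolding computable_fun_def by blast
  have p': "computes X p (n # xs) (f xs n)" if "length xs = k" for n xs
    using p[of "n # xs"] that by simp
  show ?thesis
  proof (rule computable_funI[where p = "Mu p"])
    fix xs :: "nat list" assume xs: "length xs = k"
    have "f xs (LEAST n. f xs n = 0) = 0"
      using ex[OF xs] by (auto intro: LeastI)
    moreover have "f xs m \<noteq> 0" if "m < (LEAST n. f xs n = 0)" for m
      using not_less_Least[OF that] .
    ultimately show "computes X (Mu p) xs (LEAST n. f xs n = 0)"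
      using p'[OF xs] by (intro computes.mu) metis+
  qed
qed

lemma computable_fun_add:
  assumes "computable_fun X k f" "computable_fun X k g"
  shows "computable_fun X k (\<lambda>xs. f xs + g xs)"
proof -
  have "rec_nat m (\<lambda>_. Suc) n = m + n" for m n :: nat
    by (induction n) simp_all
  moreover have "computable_fun X k (\<lambda>xs. rec_nat (f xs) (\<lambda>_. Suc) (g xs))"
    by (intro computable_fun_rec_nat assms computable_fun_Suc computable_fun_proj) simp
  ultimately show ?thesis by simp
qed

lemma computable_fun_pred:
  assumes "computable_fun X k f"
  shows "computable_fun X k (\<lambda>xs. f xs - 1)"
proof -
  have "rec_nat 0 (\<lambda>n _. n) n = n - 1" for n :: nat
    by (cases n) simp_all
  moreover have "computable_fun X k (\<lambda>xs. rec_nat 0 (\<lambda>n _. n) (f xs))"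
    by (intro computable_fun_rec_nat assms computable_fun_const computable_fun_proj) simp
  ultimately show ?thesis by simp
qed

lemma computable_fun_diff:
  assumes "computable_fun X k f" "computable_fun X k g"
  shows "computable_fun X k (\<lambda>xs. f xs - g xs)"
proof -
  have "rec_nat m (\<lambda>_ r. r - 1) n = m - n" for m n :: nat
    by (induction n) simp_all
  moreover have "computable_fun X k (\<lambda>xs. rec_nat (f xs) (\<lambda>_ r. r - 1) (g xs))"
    by (intro computable_fun_rec_nat assms computable_fun_pred computable_fun_proj) simp
  ultimately show ?thesis by simp
qed

lemma computable_fun_triangle:
  assumes "computable_fun X k f"
  shows "computable_fun X k (\<lambda>xs. triangle (f xs))"
proof -
  have "rec_nat 0 (\<lambda>n r. r + Suc n) n = triangle n" for n
    by (induction n) simp_all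
  moreover have "computable_fun X k (\<lambda>xs. rec_nat 0 (\<lambda>n r. r + Suc n) (f xs))"
    by (intro computable_fun_rec_nat assms computable_fun_add computable_fun_Suc
        computable_fun_const computable_fun_proj) simp_all
  ultimately show ?thesis by simp
qed

definition pfst :: "nat \<Rightarrow> nat" where "pfst z = fst (prod_decode z)"
definition psnd :: "nat \<Rightarrow> nat" where "psnd z = snd (prod_decode z)"

lemma pfst_prod_encode [simp]: "pfst (prod_encode (a, b)) = a"
  and psnd_prod_encode [simp]: "psnd (prod_encode (a, b)) = b"
  and prod_encode_pfst_psnd [simp]: "prod_encode (pfst z, psnd z) = z"
  by (simp_all add: pfst_def psnd_def)

lemma triangle_mono: "m \<le> n \<Longrightarrow> triangle m \<le> triangle n"
  by (rule lift_Suc_mono_le[of triangle]) simp_all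

lemma pfst_plus_psnd: "pfst z + psnd z = (LEAST w. Suc z - triangle (Suc w) = 0)"
proof (rule sym, rule Least_equality)
  have z: "z = triangle (pfst z + psnd z) + pfst z"
    using prod_encode_pfst_psnd[of z] unfolding prod_encode_def by simp
  then show "Suc z - triangle (Suc (pfst z + psnd z)) = 0" by simp
  fix w assume w: "Suc z - triangle (Suc w) = 0"
  show "pfst z + psnd z \<le> w"
  proof (rule ccontr)
    assume "\<not> ?thesis"
    then have "triangle (Suc w) \<le> triangle (pfst z + psnd z)"
      by (intro triangle_mono) simp
    with w z show False by linarith
  qed
qed

lemma computable_fun_prod_encode:
  assumes "computable_fun X k f" "computable_fun X k g"
  shows "computable_fun X k (\<lambda>xs. prod_encode (f xs, g xs))"
  unfolding prod_encode_def
  by (simp, intro computable_fun_add computable_fun_triangle assms)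

lemma computable_fun_pfst_plus_psnd:
  assumes "computable_fun X k f"
  shows "computable_fun X k (\<lambda>xs. pfst (f xs) + psnd (f xs))"
  unfolding pfst_plus_psnd
proof (rule computable_fun_Least)
  show "computable_fun X (1 + k) (\<lambda>zs. Suc (f (drop 1 zs)) - triangle (Suc (zs ! 0)))"
    by (intro computable_fun_diff computable_fun_triangle computable_fun_Suc computable_fun_proj
        computable_fun_drop assms) simp
  show "\<exists>n. Suc (f xs) - triangle (Suc n) = 0" for xs
    by (rule exI[of _ "f xs"]) simp
qed

lemma computable_fun_pfst:
  assumes "computable_fun X k f"
  shows "computable_fun X k (\<lambda>xs. pfst (f xs))"
proof -
  have "z - triangle (pfst z + psnd z) = pfst z" for z
    using prod_encode_pfst_psnd[of z] unfolding prod_encode_def by simp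
  moreover have "computable_fun X k (\<lambda>xs. f xs - triangle (pfst (f xs) + psnd (f xs)))"
    by (intro computable_fun_diff computable_fun_triangle computable_fun_pfst_plus_psnd assms)
  ultimately show ?thesis by simp
qed

lemma computable_fun_psnd:
  assumes "computable_fun X k f"
  shows "computable_fun X k (\<lambda>xs. psnd (f xs))"
proof -
  have "computable_fun X k (\<lambda>xs. (pfst (f xs) + psnd (f xs)) - pfst (f xs))"
    by (intro computable_fun_diff computable_fun_pfst computable_fun_pfst_plus_psnd assms)
  then show ?thesis by simp
qed

definition recfn :: "nat set \<Rightarrow> (nat \<Rightarrow> nat) \<Rightarrow> bool" where
  "recfn X f \<longleftrightarrow> (\<exists>p. \<forall>x. computes X p [x] (f x))"

definition decidable :: "nat set \<Rightarrow> (nat \<Rightarrow> bool) \<Rightarrow> bool" where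
  "decidable X P \<longleftrightarrow> recfn X (\<lambda>x. of_bool (P x))"

lemma recfn_iff: "recfn X f \<longleftrightarrow> computable_fun X 1 (\<lambda>xs. f (xs ! 0))"
proof -
  have "(\<forall>xs. length xs = 1 \<longrightarrow> computes X p xs (f (xs ! 0))) \<longleftrightarrow> (\<forall>x. computes X p [x] (f x))" for p
    by (auto simp: length_Suc_conv)
  then show ?thesis unfolding recfn_def computable_fun_def by simp
qed

lemma computable_fun_recfn:
  assumes "recfn X f" "computable_fun X k g"
  shows "computable_fun X k (\<lambda>xs. f (g xs))"
  using computable_fun_comp[of X "[g]" "\<lambda>xs. f (xs ! 0)" k] assms by (simp add: recfn_iff)

text \<open>
  From here on, functions of several variables are unary functions of nested pairs. A rule for a
  binder has the body as a predicate of the pair formed by the parameter and the bound variable.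
\<close>

named_theorems recfn_intros

lemma recfn_id [recfn_intros]: "recfn X (\<lambda>x. x)"
  unfolding recfn_iff by (rule computable_fun_proj) simp

lemma recfn_const [recfn_intros]: "recfn X (\<lambda>x. c)"
  unfolding recfn_iff by (rule computable_fun_const)

lemma recfn_Suc [recfn_intros]: "recfn X f \<Longrightarrow> recfn X (\<lambda>x. Suc (f x))"
  unfolding recfn_iff by (rule computable_fun_Suc)

lemma recfn_add [recfn_intros]: "recfn X f \<Longrightarrow> recfn X g \<Longrightarrow> recfn X (\<lambda>x. f x + g x)"
  unfolding recfn_iff by (rule computable_fun_add)

lemma recfn_diff [recfn_intros]: "recfn X f \<Longrightarrow> recfn X g \<Longrightarrow> recfn X (\<lambda>x. f x - g x)"
  unfolding recfn_iff by (rule computable_fun_diff)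

lemma recfn_prod_encode [recfn_intros]:
  "recfn X f \<Longrightarrow> recfn X g \<Longrightarrow> recfn X (\<lambda>x. prod_encode (f x, g x))"
  unfolding recfn_iff by (rule computable_fun_prod_encode)

lemma recfn_pfst [recfn_intros]: "recfn X f \<Longrightarrow> recfn X (\<lambda>x. pfst (f x))"
  unfolding recfn_iff by (rule computable_fun_pfst)

lemma recfn_psnd [recfn_intros]: "recfn X f \<Longrightarrow> recfn X (\<lambda>x. psnd (f x))"
  unfolding recfn_iff by (rule computable_fun_psnd)

lemma recfn_comp: "recfn X f \<Longrightarrow> recfn X g \<Longrightarrow> recfn X (\<lambda>x. f (g x))"
  using computable_fun_recfn by (auto simp: recfn_iff)

lemma recfn_rec_nat [recfn_intros]:
  assumes "recfn X a" "recfn X (\<lambda>z. b (pfst z) (pfst (psnd z)) (psnd (psnd z)))" "recfn X n"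
  shows "recfn X (\<lambda>x. rec_nat (a x) (b x) (n x))"
proof -
  have "computable_fun X (2 + 1) (\<lambda>zs. prod_encode (zs ! 2, prod_encode (zs ! 0, zs ! 1)))"
    by (intro computable_fun_prod_encode computable_fun_proj) simp_all
  from computable_fun_recfn[OF assms(2) this]
  have "computable_fun X (2 + 1) (\<lambda>zs. b (drop 2 zs ! 0) (zs ! 0) (zs ! 1))"
    by (rule computable_fun_cong) simp
  then show ?thesis
    using assms(1,3) unfolding recfn_iff by (rule_tac computable_fun_rec_nat)
qed

lemma decidable_Least [recfn_intros]:
  assumes "decidable X (\<lambda>z. P (pfst z) (psnd z))" "\<And>x. \<exists>n. P x n"
  shows "recfn X (\<lambda>x. LEAST n. P x n)"
proof -
  have "recfn X (\<lambda>z. 1 - of_bool (P (pfst z) (psnd z)))"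
    using assms(1) unfolding decidable_def by (intro recfn_intros)
  moreover have "computable_fun X (1 + 1) (\<lambda>zs. prod_encode (zs ! 1, zs ! 0))"
    by (intro computable_fun_prod_encode computable_fun_proj) simp_all
  ultimately have "computable_fun X (1 + 1) (\<lambda>zs. 1 - of_bool (P (zs ! 1) (zs ! 0)))"
    using computable_fun_recfn by fastforce
  then have "computable_fun X (1 + 1) (\<lambda>zs. 1 - of_bool (P (drop 1 zs ! 0) (zs ! 0)))"
    by (rule computable_fun_cong) simp
  then have "computable_fun X 1 (\<lambda>xs. LEAST n. 1 - of_bool (P (xs ! 0) n) = (0 :: nat))"
    using assms(2) by (rule_tac computable_fun_Least) auto
  moreover have "1 - of_bool Q = (0 :: nat) \<longleftrightarrow> Q" for Q by simp
  ultimately show ?thesis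
    unfolding recfn_iff by simp
qed

lemma recfn_mult [recfn_intros]:
  assumes "recfn X f" "recfn X g" shows "recfn X (\<lambda>x. f x * g x)"
proof -
  have "rec_nat 0 (\<lambda>_ r. r + m) n = m * n" for m n :: nat
    by (induction n) simp_all
  moreover have "recfn X (\<lambda>x. rec_nat 0 (\<lambda>_ r. r + f x) (g x))"
    by (intro recfn_comp[OF assms(1)] recfn_intros assms)
  ultimately show ?thesis by simp
qed

lemma recfn_power [recfn_intros]:
  assumes "recfn X f" "recfn X g" shows "recfn X (\<lambda>x. f x ^ g x)"
proof -
  have "rec_nat 1 (\<lambda>_ r. r * m) n = m ^ n" for m n :: nat
    by (induction n) simp_all
  moreover have "recfn X (\<lambda>x. rec_nat 1 (\<lambda>_ r. r * f x) (g x))"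
    by (intro recfn_comp[OF assms(1)] recfn_intros assms)
  ultimately show ?thesis by simp
qed

lemma recfn_of_bool [recfn_intros]: "decidable X P \<Longrightarrow> recfn X (\<lambda>x. of_bool (P x))"
  by (simp add: decidable_def)

lemma decidable_comp: "decidable X P \<Longrightarrow> recfn X f \<Longrightarrow> decidable X (\<lambda>x. P (f x))"
  unfolding decidable_def by (rule recfn_comp)

lemma decidable_oracle [recfn_intros]: "recfn X f \<Longrightarrow> decidable X (\<lambda>x. f x \<in> X)"
  by (rule decidable_comp[of _ "\<lambda>x. x \<in> X"])
    (unfold decidable_def recfn_def, intro exI[of _ Query] allI computes.query)

lemma decidable_not [recfn_intros]: assumes "decidable X P" shows "decidable X (\<lambda>x. \<not> P x)"
proof -
  have "recfn X (\<lambda>x. 1 - of_bool (P x))" by (intro recfn_intros assms)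
  moreover have "1 - of_bool Q = (of_bool (\<not> Q) :: nat)" for Q by simp
  ultimately show ?thesis unfolding decidable_def by simp
qed

lemma decidable_conj [recfn_intros]:
  assumes "decidable X P" "decidable X Q" shows "decidable X (\<lambda>x. P x \<and> Q x)"
  unfolding decidable_def of_bool_conj by (intro recfn_intros assms)

lemma decidable_disj [recfn_intros]:
  assumes "decidable X P" "decidable X Q" shows "decidable X (\<lambda>x. P x \<or> Q x)"
proof -
  have "decidable X (\<lambda>x. \<not> (\<not> P x \<and> \<not> Q x))" by (intro recfn_intros assms)
  then show ?thesis by simp
qed

lemma decidable_imp [recfn_intros]:
  assumes "decidable X P" "decidable X Q" shows "decidable X (\<lambda>x. P x \<longrightarrow> Q x)"
  unfolding imp_conv_disj by (intro recfn_intros assms)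

lemma decidable_le [recfn_intros]:
  assumes "recfn X f" "recfn X g" shows "decidable X (\<lambda>x. f x \<le> g x)"
proof -
  have "recfn X (\<lambda>x. 1 - (f x - g x))" by (intro recfn_intros assms)
  moreover have "1 - (m - n) = (of_bool (m \<le> n) :: nat)" for m n :: nat by auto
  ultimately show ?thesis unfolding decidable_def by simp
qed

lemma decidable_less [recfn_intros]:
  "recfn X f \<Longrightarrow> recfn X g \<Longrightarrow> decidable X (\<lambda>x. f x < g x)"
  unfolding less_eq_Suc_le by (intro recfn_intros)

lemma decidable_eq [recfn_intros]:
  "recfn X f \<Longrightarrow> recfn X g \<Longrightarrow> decidable X (\<lambda>x. f x = g x)"
  unfolding eq_iff by (intro recfn_intros)

lemma decidable_bex [recfn_intros]:
  assumes "recfn X n" "decidable X (\<lambda>z. P (pfst z) (psnd z))"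
  shows "decidable X (\<lambda>x. \<exists>i<n x. P x i)"
proof -
  have "recfn X (\<lambda>x. LEAST i. n x \<le> i \<or> P x i)"
    by (intro recfn_comp[OF assms(1)] recfn_intros assms) blast
  then have "decidable X (\<lambda>x. (LEAST i. n x \<le> i \<or> P x i) < n x)"
    by (rule decidable_less[OF _ assms(1)])
  moreover have "(LEAST i. n x \<le> i \<or> P x i) < n x \<longleftrightarrow> (\<exists>i<n x. P x i)" for x
  proof
    assume "(LEAST i. n x \<le> i \<or> P x i) < n x"
    moreover have "n x \<le> (LEAST i. n x \<le> i \<or> P x i) \<or> P x (LEAST i. n x \<le> i \<or> P x i)"
      by (rule LeastI[of _ "n x"]) simp
    ultimately show "\<exists>i<n x. P x i" by force
  next
    assume "\<exists>i<n x. P x i"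
    then show "(LEAST i. n x \<le> i \<or> P x i) < n x"
      by (metis (mono_tags, lifting) Least_le le_less_trans)
  qed
  ultimately show ?thesis by simp
qed

lemma decidable_ball [recfn_intros]:
  assumes "recfn X n" "decidable X (\<lambda>z. P (pfst z) (psnd z))"
  shows "decidable X (\<lambda>x. \<forall>i<n x. P x i)"
proof -
  have "decidable X (\<lambda>x. \<not> (\<exists>i<n x. \<not> P x i))" by (intro recfn_intros assms)
  then show ?thesis by simp
qed

lemma recfn_div_power:
  assumes "recfn X f" "recfn X g" shows "recfn X (\<lambda>x. f x div 2 ^ g x)"
proof -
  have "(LEAST q. m < 2 ^ n * Suc q) = m div 2 ^ n" for m n :: nat
  proof (rule Least_equality)
    show "m < 2 ^ n * Suc (m div 2 ^ n)"
      by (metis dividend_less_times_div mult_Suc_right zero_less_numeral zero_less_power)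
  next
    fix q assume "m < 2 ^ n * Suc q"
    then show "m div 2 ^ n \<le> q"
      by (metis less_Suc_eq_le less_mult_imp_div_less mult.commute)
  qed
  moreover have "recfn X (\<lambda>x. LEAST q. f x < 2 ^ g x * Suc q)"
  proof (intro recfn_comp[OF assms(1)] recfn_comp[OF assms(2)] recfn_intros)
    show "\<exists>q. f x < 2 ^ g x * Suc q" for x
      by (rule exI[of _ "f x"])
        (metis One_nat_def Suc_le_eq lessI less_le_trans mult_le_mono1 nat_mult_1
          zero_less_numeral zero_less_power)
  qed
  ultimately show ?thesis by simp
qed

lemma recfn_div2 [recfn_intros]:
  "recfn X f \<Longrightarrow> recfn X (\<lambda>x. f x div 2)"
  using recfn_div_power[of X f "\<lambda>_. 1"] by (simp add: recfn_const)

lemma decidable_even [recfn_intros]: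
  assumes "recfn X f" shows "decidable X (\<lambda>x. even (f x))"
proof -
  have "decidable X (\<lambda>x. 2 * (f x div 2) = f x)" by (intro recfn_intros assms)
  moreover have "2 * (n div 2) = n \<longleftrightarrow> even n" for n :: nat by presburger
  ultimately show ?thesis by simp
qed

lemma decidable_set_decode [recfn_intros]:
  "recfn X f \<Longrightarrow> recfn X g \<Longrightarrow> decidable X (\<lambda>x. f x \<in> set_decode (g x))"
  unfolding set_decode_def by (simp, intro recfn_intros recfn_div_power)

lemma recfn_set_encode [recfn_intros]:
  assumes "recfn X n" "decidable X (\<lambda>z. P (pfst z) (psnd z))"
  shows "recfn X (\<lambda>x. set_encode {t. t < n x \<and> P x t})"
proof -
  have "rec_nat 0 (\<lambda>t r. r + of_bool (Q t) * 2 ^ t) m = set_encode {t. t < m \<and> Q t}" for Q m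
  proof (induction m)
    case (Suc m)
    have "{t. t < Suc m \<and> Q t} = (if Q m then insert m else id) {t. t < m \<and> Q t}"
      by (auto simp: less_Suc_eq)
    then show ?case using Suc by (simp add: set_encode_insert)
  qed (simp add: set_encode_def)
  moreover have "decidable X (\<lambda>z. P (pfst z) (pfst (psnd z)))"
    using decidable_comp[OF assms(2), of "\<lambda>z. prod_encode (pfst z, pfst (psnd z))"]
    by (simp add: recfn_intros)
  then have "recfn X (\<lambda>x. rec_nat 0 (\<lambda>t r. r + of_bool (P x t) * 2 ^ t) (n x))"
    by (intro recfn_intros assms)
  ultimately show ?thesis by simp
qed

section \<open>A uniform approximation to all computations\<close>

text \<open>Numerical counterparts of the list operations, for lists coded by \<^const>\<open>list_encode\<close>.\<close>

definition lcons :: "nat \<Rightarrow> nat \<Rightarrow> nat" where "lcons a c = Suc (prod_encode (a, c))"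
definition ltl :: "nat \<Rightarrow> nat" where "ltl c = psnd (c - 1)"
definition lnth :: "nat \<Rightarrow> nat \<Rightarrow> nat" where "lnth c i = pfst ((ltl ^^ i) c - 1)"
definition llen :: "nat \<Rightarrow> nat" where "llen c = (LEAST n. (ltl ^^ n) c = 0)"

declare list_encode.simps(2) [simp del]

lemma ltl_0 [simp]: "ltl 0 = 0"
  by (simp add: ltl_def psnd_def prod_decode_def prod_decode_aux.simps)

lemma lcons_list_encode [simp]: "lcons x (list_encode xs) = list_encode (x # xs)"
  by (simp add: lcons_def list_encode.simps(2))

lemma ltl_list_encode [simp]: "ltl (list_encode (x # xs)) = list_encode xs"
  by (simp add: ltl_def list_encode.simps(2))

lemma ltl_funpow_list_encode: "(ltl ^^ i) (list_encode xs) = list_encode (drop i xs)"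
proof (induction i arbitrary: xs)
  case (Suc i)
  then show ?case by (cases xs) (simp_all add: funpow_Suc_right Suc[of "[]", simplified] del: funpow.simps)
qed simp

lemma lnth_list_encode [simp]: "i < length xs \<Longrightarrow> lnth (list_encode xs) i = xs ! i"
  by (simp add: lnth_def ltl_funpow_list_encode list_encode.simps(2) flip: Cons_nth_drop_Suc)

lemma list_encode_eq_0 [simp]: "list_encode xs = 0 \<longleftrightarrow> xs = []"
  by (cases xs) (simp_all add: list_encode.simps(2))

lemma llen_list_encode [simp]: "llen (list_encode xs) = length xs"
  unfolding llen_def by (rule Least_equality) (simp_all add: ltl_funpow_list_encode)

lemma recfn_lcons [recfn_intros]: "recfn X f \<Longrightarrow> recfn X g \<Longrightarrow> recfn X (\<lambda>x. lcons (f x) (g x))"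
  unfolding lcons_def by (intro recfn_intros)

lemma recfn_ltl [recfn_intros]: "recfn X f \<Longrightarrow> recfn X (\<lambda>x. ltl (f x))"
  unfolding ltl_def by (intro recfn_intros)

lemma recfn_ltl_funpow [recfn_intros]:
  assumes "recfn X f" "recfn X g" shows "recfn X (\<lambda>x. (ltl ^^ g x) (f x))"
proof -
  have "rec_nat c (\<lambda>_. ltl) n = (ltl ^^ n) c" for c n
    by (induction n) simp_all
  moreover have "recfn X (\<lambda>x. rec_nat (f x) (\<lambda>_. ltl) (g x))"
    by (intro recfn_intros assms)
  ultimately show ?thesis by simp
qed

lemma recfn_lnth [recfn_intros]: "recfn X f \<Longrightarrow> recfn X g \<Longrightarrow> recfn X (\<lambda>x. lnth (f x) (g x))"
  unfolding lnth_def by (intro recfn_intros)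

lemma recfn_llen [recfn_intros]:
  assumes "recfn X f" shows "recfn X (\<lambda>x. llen (f x))"
  unfolding llen_def
proof (intro recfn_intros recfn_comp[OF assms])
  show "\<exists>n. (ltl ^^ n) (f x) = 0" for x
    by (metis drop_all ltl_funpow_list_encode list_decode_inverse list_encode_eq_0 order_refl)
qed

fun prog_code :: "prog \<Rightarrow> nat" where
  "prog_code Zero = prod_encode (0, 0)"
| "prog_code Succ = prod_encode (1, 0)"
| "prog_code Query = prod_encode (2, 0)"
| "prog_code (Proj i) = prod_encode (3, i)"
| "prog_code (Comp f gs) = prod_encode (4, prod_encode (prog_code f, list_encode (map prog_code gs)))"
| "prog_code (PrimRec f g) = prod_encode (5, prod_encode (prog_code f, prog_code g))"
| "prog_code (Mu f) = prod_encode (6, prog_code f)"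

definition triple :: "nat \<Rightarrow> nat \<Rightarrow> nat \<Rightarrow> nat" where
  "triple p xs y = prod_encode (p, prod_encode (xs, y))"

text \<open>
  \<open>step X s D\<close> holds of a triple if it follows by one rule of \<^const>\<open>computes\<close> from triples in \<open>D\<close>.
  The bound \<open>s\<close> on witnesses makes this decidable, and the bound on queries makes \<open>stage X s\<close>
  depend only on \<open>X \<inter> {..<s}\<close>.
\<close>

definition step :: "nat set \<Rightarrow> nat \<Rightarrow> nat set \<Rightarrow> nat \<Rightarrow> nat \<Rightarrow> nat \<Rightarrow> bool" where
  "step X s D p xs y \<longleftrightarrow>
     pfst p = 0 \<and> y = 0
   \<or> pfst p = 1 \<and> xs = lcons (lnth xs 0) 0 \<and> y = Suc (lnth xs 0)
   \<or> pfst p = 2 \<and> xs = lcons (lnth xs 0) 0 \<and> lnth xs 0 < s \<and> y = of_bool (lnth xs 0 \<in> X)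
   \<or> pfst p = 3 \<and> psnd p < llen xs \<and> y = lnth xs (psnd p)
   \<or> pfst p = 4 \<and> (\<exists>ys<s. llen ys = llen (psnd (psnd p)) \<and> triple (pfst (psnd p)) ys y \<in> D \<and>
        (\<forall>i<llen ys. triple (lnth (psnd (psnd p)) i) xs (lnth ys i) \<in> D))
   \<or> pfst p = 5 \<and> xs \<noteq> 0 \<and> lnth xs 0 = 0 \<and> triple (pfst (psnd p)) (ltl xs) y \<in> D
   \<or> pfst p = 5 \<and> xs \<noteq> 0 \<and> lnth xs 0 \<noteq> 0 \<and>
        (\<exists>r<s. triple p (lcons (lnth xs 0 - 1) (ltl xs)) r \<in> D \<and>
           triple (psnd (psnd p)) (lcons (lnth xs 0 - 1) (lcons r (ltl xs))) y \<in> D)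
   \<or> pfst p = 6 \<and> triple (psnd p) (lcons y xs) 0 \<in> D \<and>
        (\<forall>m<y. \<exists>r<s. r \<noteq> 0 \<and> triple (psnd p) (lcons m xs) r \<in> D)"

fun stage :: "nat set \<Rightarrow> nat \<Rightarrow> nat set" where
  "stage X 0 = {}"
| "stage X (Suc s) =
     {t. t < Suc s \<and> step X s (stage X s) (pfst t) (pfst (psnd t)) (psnd (psnd t))}"

lemma step_mono:
  assumes "step X s D p xs y" "s \<le> s'" "D \<subseteq> D'"
  shows "step X s' D' p xs y"
  using assms(1) unfolding step_def
  by (elim disj_forward conj_forward ex_forward all_forward imp_forward)
    (use assms(2,3) in \<open>auto elim: less_le_trans\<close>)

lemma step_cong:
  assumes "X \<inter> {..<s} = Y \<inter> {..<s}"
  shows "step X s D p xs y \<longleftrightarrow> step Y s D p xs y"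
proof -
  have "lnth xs 0 < s \<Longrightarrow> lnth xs 0 \<in> X \<longleftrightarrow> lnth xs 0 \<in> Y"
    using assms by blast
  then show ?thesis unfolding step_def by (simp cong: conj_cong)
qed

lemma stage_cong: "X \<inter> {..<s} = Y \<inter> {..<s} \<Longrightarrow> stage X s = stage Y s"
proof (induction s)
  case (Suc s)
  have "A \<inter> {..<s} = A \<inter> {..<Suc s} \<inter> {..<s}" for A :: "nat set" by auto
  then have eq: "X \<inter> {..<s} = Y \<inter> {..<s}" using Suc.prems by metis
  show ?case unfolding stage.simps Suc.IH[OF eq] step_cong[OF eq] ..
qed simp

lemma stage_subset_Suc: "stage X s \<subseteq> stage X (Suc s)"
proof (induction s)
  case (Suc s)
  then show ?case by (auto intro: step_mono)
qed simp

lemma stage_mono: "s \<le> s' \<Longrightarrow> stage X s \<subseteq> stage X s'"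
  by (rule lift_Suc_mono_le[of "stage X"]) (rule stage_subset_Suc)

lemma stage_bound: "t \<in> stage X s \<Longrightarrow> t < s"
  by (cases s) auto

lemma finite_stage: "finite (stage X s)"
  by (rule finite_subset[of _ "{..<s}"]) (auto dest: stage_bound)

lemma stage_sound:
  "triple (prog_code p) (list_encode xs) y \<in> stage X s \<Longrightarrow> computes X p xs y"
proof (induction s arbitrary: p xs y)
  case (Suc s)
  then have step: "step X s (stage X s) (prog_code p) (list_encode xs) y"
    by (simp add: triple_def)
  have single: "\<exists>x. xs = [x]" if "list_encode xs = lcons (lnth (list_encode xs) 0) 0"
    using that lcons_list_encode[of _ "[]"] list_encode_eq by (metis list_encode.simps(1))
  show ?case
  proof (cases p)
    case Zero
    then show ?thesis using step by (auto simp: step_def intro: computes.zero)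
  next
    case Succ
    with step have c: "list_encode xs = lcons (lnth (list_encode xs) 0) 0"
      and y: "y = Suc (lnth (list_encode xs) 0)"
      by (simp_all add: step_def)
    from single[OF c] obtain x where "xs = [x]" by blast
    then show ?thesis using Succ y computes.succ[of X x] by simp
  next
    case Query
    with step have c: "list_encode xs = lcons (lnth (list_encode xs) 0) 0"
      and y: "y = of_bool (lnth (list_encode xs) 0 \<in> X)"
      by (simp_all add: step_def)
    from single[OF c] obtain x where "xs = [x]" by blast
    then show ?thesis using Query y computes.query[of X x] by simp
  next
    case (Proj i)
    then show ?thesis using step by (auto simp: step_def intro: computes.proj)
  next
    case (Comp f gs)
    then obtain c where c: "llen c = length gs" "triple (prog_code f) c y \<in> stage X s"
      "\<forall>i<llen c. triple (lnth (list_encode (map prog_code gs)) i) (list_encode xs) (lnth c i)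
        \<in> stage X s"
      using step by (auto simp: step_def)
    obtain ys where ys: "c = list_encode ys" by (metis list_decode_inverse)
    have "list_all2 (\<lambda>g y. computes X g xs y) gs ys"
      unfolding list_all2_conv_all_nth using c by (auto simp: ys intro!: Suc.IH)
    moreover have "computes X f ys y"
      using c(2) by (auto simp: ys intro: Suc.IH)
    ultimately show ?thesis using Comp by (auto intro: computes.comp)
  next
    case (PrimRec f g)
    then obtain x xs' where xs: "xs = x # xs'"
      using step by (cases xs) (auto simp: step_def)
    show ?thesis
    proof (cases x)
      case 0
      then show ?thesis using step PrimRec Suc.IH xs
        by (auto simp: step_def intro!: computes.primrec_0)
    next
      case (Suc n)
      then obtain r where "triple (prog_code p) (list_encode (n # xs')) r \<in> stage X s"
        "triple (prog_code g) (list_encode (n # r # xs')) y \<in> stage X s"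
        using step PrimRec xs by (auto simp: step_def simp del: prog_code.simps) auto
      then show ?thesis using Suc.IH PrimRec Suc xs by (auto intro!: computes.primrec_Suc)
    qed
  next
    case (Mu f)
    then have "triple (prog_code f) (list_encode (y # xs)) 0 \<in> stage X s"
      "\<forall>m<y. \<exists>r<s. r \<noteq> 0 \<and> triple (prog_code f) (list_encode (m # xs)) r \<in> stage X s"
      using step by (auto simp: step_def)
    then show ?thesis using Mu Suc.IH by (auto intro!: computes.mu) blast
  qed
qed simp

inductive_cases computes_ZeroE: "computes X Zero xs y"
inductive_cases computes_SuccE: "computes X Succ xs y"
inductive_cases computes_QueryE: "computes X Query xs y"
inductive_cases computes_ProjE: "computes X (Proj i) xs y"
inductive_cases computes_CompE: "computes X (Comp f gs) xs y"
inductive_cases computes_PrimRec_0E: "computes X (PrimRec f g) (0 # xs) y"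
inductive_cases computes_PrimRec_SucE: "computes X (PrimRec f g) (Suc n # xs) y"
inductive_cases computes_MuE: "computes X (Mu f) xs y"

lemma computes_deterministic: "computes X p xs y \<Longrightarrow> computes X p xs z \<Longrightarrow> y = z"
proof (induction arbitrary: z rule: computes.induct)
  case (comp xs gs ys f y)
  from comp.prems obtain ys' where ys': "list_all2 (\<lambda>g y. computes X g xs y) gs ys'"
    and f: "computes X f ys' z" by (rule computes_CompE)
  have "ys = ys'"
    using comp.IH(1) ys' by (auto simp: list_all2_conv_all_nth intro!: nth_equalityI)
  then show ?case using comp.IH(2) f by simp
next
  case (primrec_Suc f g n xs r y)
  from primrec_Suc.prems show ?case
    by (rule computes_PrimRec_SucE) (metis primrec_Suc.IH)
next
  case (mu f n xs)
  from mu.prems obtain "computes X f (z # xs) 0"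
    and z: "\<And>m. m < z \<Longrightarrow> \<exists>y. y \<noteq> 0 \<and> computes X f (m # xs) y"
    by (rule computes_MuE) auto
  then have "\<not> z < n" using mu.IH(2) by blast
  moreover have "\<not> n < z" using mu.IH(1) z by blast
  ultimately show ?case by simp
qed (erule computes_ZeroE computes_SuccE computes_QueryE computes_ProjE computes_PrimRec_0E, simp)+

lemma eventually_stageI:
  assumes "\<forall>\<^sub>F s in sequentially. step X s (stage X s) p xs y"
  shows "\<forall>\<^sub>F s in sequentially. triple p xs y \<in> stage X s"
proof -
  obtain s where s: "step X s (stage X s) p xs y" "triple p xs y \<le> s"
    using eventually_conj[OF assms eventually_ge_at_top[of "triple p xs y"]]
    by (auto simp: eventually_sequentially)
  then have "triple p xs y \<in> stage X (Suc s)"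
    by (simp add: triple_def)
  then show ?thesis
    using stage_mono unfolding eventually_sequentially by blast
qed

lemma stage_complete:
  "computes X p xs y \<Longrightarrow>
    \<forall>\<^sub>F s in sequentially. triple (prog_code p) (list_encode xs) y \<in> stage X s"
proof (induction rule: computes.induct)
  case (zero xs)
  show ?case by (rule eventually_stageI) (simp add: step_def)
next
  case (succ x)
  have "step X s (stage X s) (prog_code Succ) (list_encode [x]) (Suc x)" for s
    using lcons_list_encode[of x "[]"] by (simp add: step_def)
  then show ?case by (intro eventually_stageI) simp
next
  case (query x)
  have "step X s (stage X s) (prog_code Query) (list_encode [x]) (of_bool (x \<in> X))" if "x < s" for s
    using that lcons_list_encode[of x "[]"] by (simp add: step_def)
  then show ?case by (intro eventually_stageI eventually_mono[OF eventually_gt_at_top[of x]])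
next
  case (proj i xs)
  then show ?case by (intro eventually_stageI) (simp add: step_def)
next
  case (comp xs gs ys f y)
  have args: "\<forall>\<^sub>F s in sequentially. \<forall>i\<in>{..<length ys}.
      triple (prog_code (gs ! i)) (list_encode xs) (ys ! i) \<in> stage X s"
    by (rule eventually_ball_finite) (use comp.IH(1) in \<open>auto simp: list_all2_conv_all_nth\<close>)
  have len: "length gs = length ys"
    using comp.IH(1) by (rule list_all2_lengthD)
  show ?case
  proof (rule eventually_stageI)
    show "\<forall>\<^sub>F s in sequentially. step X s (stage X s) (prog_code (Comp f gs)) (list_encode xs) y"
      using args comp.IH(2) eventually_gt_at_top[of "list_encode ys"]
      by eventually_elim (use len in \<open>auto simp: step_def intro!: exI[of _ "list_encode ys"]\<close>)
  qed
next
  case (primrec_0 f xs y g)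
  from primrec_0.IH show ?case
    by (intro eventually_stageI) (auto elim!: eventually_mono simp: step_def)
next
  case (primrec_Suc f g n xs r y)
  show ?case
  proof (rule eventually_stageI)
    show "\<forall>\<^sub>F s in sequentially. step X s (stage X s) (prog_code (PrimRec f g)) (list_encode (Suc n # xs)) y"
      using primrec_Suc.IH eventually_gt_at_top[of r]
      by eventually_elim (auto simp: step_def intro!: exI[of _ r])
  qed
next
  case (mu f n xs)
  then obtain r where r: "\<And>m. m < n \<Longrightarrow> r m \<noteq> 0"
    "\<And>m. m < n \<Longrightarrow> \<forall>\<^sub>F s in sequentially. triple (prog_code f) (list_encode (m # xs)) (r m) \<in> stage X s"
    by metis
  have args: "\<forall>\<^sub>F s in sequentially. \<forall>m\<in>{..<n}. r m < s \<and>
      triple (prog_code f) (list_encode (m # xs)) (r m) \<in> stage X s"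
    by (rule eventually_ball_finite) (auto intro!: eventually_conj eventually_gt_at_top r(2))
  show ?case
  proof (rule eventually_stageI)
    show "\<forall>\<^sub>F s in sequentially. step X s (stage X s) (prog_code (Mu f)) (list_encode xs) n"
      using mu.IH(1) args by eventually_elim (use r(1) in \<open>auto simp: step_def\<close>)
  qed
qed

lemma computes_iff_stage:
  "computes X p xs y \<longleftrightarrow> (\<exists>s. triple (prog_code p) (list_encode xs) y \<in> stage X s)"
  using stage_sound stage_complete by (auto simp: eventually_sequentially) blast

lemma recfn_triple [recfn_intros]:
  "recfn X p \<Longrightarrow> recfn X xs \<Longrightarrow> recfn X y \<Longrightarrow> recfn X (\<lambda>x. triple (p x) (xs x) (y x))"
  unfolding triple_def by (intro recfn_intros)

lemma join_iff: "x \<in> A \<oplus> B \<longleftrightarrow> even x \<and> x div 2 \<in> A \<or> odd x \<and> x div 2 \<in> B"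
  unfolding join_def by (auto elim!: evenE oddE; presburger)

lemma decidable_join [recfn_intros]:
  "recfn Z f \<Longrightarrow> recfn Z g \<Longrightarrow> decidable Z (\<lambda>x. f x \<in> Z \<oplus> set_decode (g x))"
  unfolding join_iff by (intro recfn_intros)

lemma decidable_step [recfn_intros]:
  assumes "recfn Z g" "recfn Z s" "recfn Z d" "recfn Z p" "recfn Z xs" "recfn Z y"
  shows "decidable Z (\<lambda>x. step (Z \<oplus> set_decode (g x)) (s x) (set_decode (d x)) (p x) (xs x) (y x))"
  unfolding step_def
  by (intro assms[THEN recfn_comp] recfn_intros)

lemma recfn_stage [recfn_intros]:
  assumes "recfn Z g" "recfn Z s"
  shows "recfn Z (\<lambda>x. set_encode (stage (Z \<oplus> set_decode (g x)) (s x)))"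
proof -
  have "rec_nat 0 (\<lambda>s d. set_encode {t. t < Suc s \<and>
      step X s (set_decode d) (pfst t) (pfst (psnd t)) (psnd (psnd t))}) s = set_encode (stage X s)" for X s
  proof (induction s)
    case (Suc s)
    then show ?case by (simp add: set_encode_inverse finite_stage)
  qed (simp add: set_encode_def)
  moreover have "recfn Z (\<lambda>x. rec_nat 0 (\<lambda>s d. set_encode {t. t < Suc s \<and>
      step (Z \<oplus> set_decode (g x)) s (set_decode d) (pfst t) (pfst (psnd t)) (psnd (psnd t))}) (s x))"
    by (intro assms[THEN recfn_comp] recfn_intros)
  ultimately show ?thesis by simp
qed

lemma decidable_stage [recfn_intros]:
  assumes "recfn Z f" "recfn Z g" "recfn Z s"
  shows "decidable Z (\<lambda>x. f x \<in> stage (Z \<oplus> set_decode (g x)) (s x))"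
proof -
  have "decidable Z (\<lambda>x. f x \<in> set_decode (set_encode (stage (Z \<oplus> set_decode (g x)) (s x))))"
    by (intro recfn_intros assms)
  then show ?thesis by (simp add: set_encode_inverse finite_stage)
qed

section \<open>The arithmetic hierarchy via universal sets\<close>

text \<open>
  Since \<open>\<Sigma>\<^sub>n\<^sub>+\<^sub>1\<close> is \<open>\<exists>\<not>\<Sigma>\<^sub>n\<close>, a single recursion that carries the quantified variables in a nested
  pair describes all levels.
\<close>

fun Sig :: "nat \<Rightarrow> nat set \<Rightarrow> (nat \<Rightarrow> bool) \<Rightarrow> bool" where
  "Sig 0 X P \<longleftrightarrow> decidable X P"
| "Sig (Suc n) X P \<longleftrightarrow> (\<exists>Q. Sig n X Q \<and> (\<forall>m. P m \<longleftrightarrow> (\<exists>y. \<not> Q (prod_encode (m, y)))))"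

lemma Sig_comp: "Sig n X P \<Longrightarrow> recfn X f \<Longrightarrow> Sig n X (\<lambda>x. P (f x))"
proof (induction n arbitrary: P f)
  case 0
  then show ?case by (simp add: decidable_comp)
next
  case (Suc n)
  then obtain Q where Q: "Sig n X Q" "\<And>m. P m \<longleftrightarrow> (\<exists>y. \<not> Q (prod_encode (m, y)))" by auto
  have "Sig n X (\<lambda>z. Q (prod_encode (f (pfst z), psnd z)))"
    by (rule Suc.IH[OF Q(1)]) (intro recfn_comp[OF Suc.prems(2)] recfn_intros)
  then show ?case by (auto simp: Q(2) intro!: exI[of _ "\<lambda>z. Q (prod_encode (f (pfst z), psnd z))"])
qed

lemma Sig_Suc: "Sig n X P \<Longrightarrow> Sig (Suc n) X P"
proof (induction n arbitrary: P)
  case 0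
  then have "decidable X (\<lambda>z. \<not> P (pfst z))"
    using decidable_comp[of X P pfst] by (simp add: recfn_intros)
  then show ?case by (auto intro!: exI[of _ "\<lambda>z. \<not> P (pfst z)"])
next
  case (Suc n)
  then show ?case by (metis Sig.simps(2))
qed

lemma Sig_mono: "m \<le> n \<Longrightarrow> Sig m X P \<Longrightarrow> Sig n X P"
  by (induction n rule: dec_induct) (auto intro: Sig_Suc simp del: Sig.simps)

lemma Sig_conj_disj:
  "Sig n X P \<Longrightarrow> Sig n X Q \<Longrightarrow> Sig n X (\<lambda>x. P x \<and> Q x) \<and> Sig n X (\<lambda>x. P x \<or> Q x)"
proof (induction n arbitrary: P Q)
  case 0
  then show ?case by (simp add: recfn_intros)
next
  case (Suc n)
  then obtain P' Q' where P': "Sig n X P'" "\<And>m. P m \<longleftrightarrow> (\<exists>y. \<not> P' (prod_encode (m, y)))"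
    and Q': "Sig n X Q'" "\<And>m. Q m \<longleftrightarrow> (\<exists>y. \<not> Q' (prod_encode (m, y)))" by auto
  let ?C = "\<lambda>z. P' (prod_encode (pfst z, pfst (psnd z))) \<or> Q' (prod_encode (pfst z, psnd (psnd z)))"
  have "Sig n X ?C"
    using Sig_comp[OF P'(1), of "\<lambda>z. prod_encode (pfst z, pfst (psnd z))"]
      Sig_comp[OF Q'(1), of "\<lambda>z. prod_encode (pfst z, psnd (psnd z))"] Suc.IH
    by (simp add: recfn_intros)
  moreover have "P m \<and> Q m \<longleftrightarrow> (\<exists>y. \<not> ?C (prod_encode (m, y)))" for m
    by (simp add: P'(2) Q'(2)) (metis pfst_prod_encode psnd_prod_encode)
  ultimately have "Sig (Suc n) X (\<lambda>x. P x \<and> Q x)" unfolding Sig.simps by blast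
  moreover have "Sig n X (\<lambda>x. P' x \<and> Q' x)" using Suc.IH P'(1) Q'(1) by blast
  then have "Sig (Suc n) X (\<lambda>x. P x \<or> Q x)"
    using P'(2) Q'(2) by (auto intro!: exI[of _ "\<lambda>x. P' x \<and> Q' x"])
  ultimately show ?case ..
qed

definition accepts :: "nat \<Rightarrow> nat set \<Rightarrow> nat \<Rightarrow> bool" where
  "accepts s X t \<longleftrightarrow>
     (\<exists>y<s. triple (pfst t) (lcons (prod_encode (psnd t, y)) 0) 1 \<in> stage X s)"

text \<open>The index is shifted: \<open>universal n X\<close> enumerates the sets that are \<open>\<Sigma>\<^sub>n\<^sub>+\<^sub>1\<close> in \<open>X\<close>.\<close>

fun universal :: "nat \<Rightarrow> nat set \<Rightarrow> nat \<Rightarrow> nat \<Rightarrow> bool" where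
  "universal 0 X e m \<longleftrightarrow> (\<exists>s. accepts s X (prod_encode (e, m)))"
| "universal (Suc n) X e m \<longleftrightarrow> (\<exists>y. \<not> universal n X e (prod_encode (m, y)))"

lemma accepts_prog_code:
  "(\<exists>s. accepts s X (prod_encode (prog_code p, m))) \<longleftrightarrow> (\<exists>y. computes X p [prod_encode (m, y)] 1)"
proof
  assume "\<exists>s. accepts s X (prod_encode (prog_code p, m))"
  then show "\<exists>y. computes X p [prod_encode (m, y)] 1"
    using lcons_list_encode[of _ "[]"] unfolding accepts_def computes_iff_stage by auto
next
  assume "\<exists>y. computes X p [prod_encode (m, y)] 1"
  then obtain y where "computes X p [prod_encode (m, y)] 1" ..
  from eventually_conj[OF stage_complete[OF this] eventually_gt_at_top[of y]]
  obtain s where "y < s" "triple (prog_code p) (list_encode [prod_encode (m, y)]) 1 \<in> stage X s"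
    by (auto simp: eventually_sequentially)
  then show "\<exists>s. accepts s X (prod_encode (prog_code p, m))"
    using lcons_list_encode[of _ "[]"] unfolding accepts_def by auto
qed

lemma Sig_universal: "Sig (Suc n) X P \<Longrightarrow> \<exists>e. \<forall>m. P m \<longleftrightarrow> universal n X e m"
proof (induction n arbitrary: P)
  case 0
  then obtain Q where Q: "decidable X Q" "\<And>m. P m \<longleftrightarrow> (\<exists>y. \<not> Q (prod_encode (m, y)))" by auto
  from decidable_not[OF Q(1)] obtain p where p: "\<And>x. computes X p [x] (of_bool (\<not> Q x))"
    unfolding decidable_def recfn_def by blast
  have "computes X p [x] 1 \<longleftrightarrow> \<not> Q x" for x
    using p[of x] computes_deterministic[of X p "[x]" 0 1] by (cases "Q x") auto
  then have "P m \<longleftrightarrow> universal 0 X (prog_code p) m" for m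
    by (simp only: Q(2) universal.simps accepts_prog_code)
  then show ?case by blast
next
  case (Suc n)
  then show ?case by (metis Sig.simps(2) universal.simps(2))
qed

definition encode_tuple :: "nat \<Rightarrow> nat list \<Rightarrow> nat" where
  "encode_tuple = foldl (\<lambda>c y. prod_encode (c, y))"

fun decode_tuple :: "nat \<Rightarrow> nat \<Rightarrow> nat list" where
  "decode_tuple 0 m = [m]"
| "decode_tuple (Suc n) m = decode_tuple n (pfst m) @ [psnd m]"

lemma decode_encode_tuple: "decode_tuple (length ys) (encode_tuple x ys) = x # ys"
  by (induction ys rule: rev_induct) (simp_all add: encode_tuple_def)

lemma length_decode_tuple [simp]: "length (decode_tuple n m) = Suc n"
  by (induction n arbitrary: m) simp_all

lemma exists_alt_cong:
  "(\<And>ys. length ys = n \<Longrightarrow> R ys = R' ys) \<Longrightarrow> exists_alt n R = exists_alt n R'"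
  and forall_alt_cong:
  "(\<And>ys. length ys = n \<Longrightarrow> R ys = R' ys) \<Longrightarrow> forall_alt n R = forall_alt n R'"
proof (induction n arbitrary: R R')
  case (Suc n)
  { case 1
    have "forall_alt n (\<lambda>ys. R (y # ys)) = forall_alt n (\<lambda>ys. R' (y # ys))" for y
      by (rule Suc.IH(2)) (simp add: 1)
    then show ?case by simp }
  { case 2
    have "exists_alt n (\<lambda>ys. R (y # ys)) = exists_alt n (\<lambda>ys. R' (y # ys))" for y
      by (rule Suc.IH(1)) (simp add: 2)
    then show ?case by simp }
qed simp_all

lemma not_exists_alt: "\<not> exists_alt n R \<longleftrightarrow> forall_alt n (\<lambda>ys. \<not> R ys)"
  and not_forall_alt: "\<not> forall_alt n R \<longleftrightarrow> exists_alt n (\<lambda>ys. \<not> R ys)"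
  by (induction n arbitrary: R) simp_all

lemma Sig_iff_exists_alt:
  "Sig n X P \<longleftrightarrow> (\<exists>R. decidable X R \<and> (\<forall>m. P m \<longleftrightarrow> exists_alt n (\<lambda>ys. R (encode_tuple m ys))))"
proof (induction n arbitrary: P)
  case 0
  show ?case by (auto simp: encode_tuple_def fun_eq_iff[symmetric])
next
  case (Suc n)
  have flip: "(\<exists>y. \<not> exists_alt n (\<lambda>ys. \<not> R (encode_tuple (prod_encode (m, y)) ys)))
      \<longleftrightarrow> exists_alt (Suc n) (\<lambda>ys. R (encode_tuple m ys))" for m R
    by (simp add: not_exists_alt encode_tuple_def)
  show ?case
  proof
    assume "Sig (Suc n) X P"
    then obtain Q R where "decidable X R" "\<And>m. P m \<longleftrightarrow> (\<exists>y. \<not> Q (prod_encode (m, y)))"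
      "\<And>m. Q m \<longleftrightarrow> exists_alt n (\<lambda>ys. R (encode_tuple m ys))"
      using Suc by auto
    then show "\<exists>R. decidable X R \<and> (\<forall>m. P m \<longleftrightarrow> exists_alt (Suc n) (\<lambda>ys. R (encode_tuple m ys)))"
      using flip[of "\<lambda>x. \<not> R x"] by (intro exI[of _ "\<lambda>x. \<not> R x"]) (simp add: decidable_not)
  next
    assume "\<exists>R. decidable X R \<and> (\<forall>m. P m \<longleftrightarrow> exists_alt (Suc n) (\<lambda>ys. R (encode_tuple m ys)))"
    then obtain R where R: "decidable X R" "\<And>m. P m \<longleftrightarrow> exists_alt (Suc n) (\<lambda>ys. R (encode_tuple m ys))"
      by blast
    have "Sig n X (\<lambda>m. exists_alt n (\<lambda>ys. \<not> R (encode_tuple m ys)))"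
      unfolding Suc using R(1) by (intro exI[of _ "\<lambda>x. \<not> R x"]) (simp add: decidable_not)
    then show "Sig (Suc n) X P"
      unfolding Sig.simps R(2) flip[symmetric] by blast
  qed
qed

lemma computable_rel_encode_tuple:
  assumes "decidable X R"
  shows "computable_rel X (Suc n) (\<lambda>xs. R (encode_tuple (hd xs) (tl xs)))"
proof -
  have "computable_fun X (Suc n) (\<lambda>xs. encode_tuple (xs ! 0) (take j (tl xs)))" if "j \<le> n" for j
    using that
  proof (induction j)
    case 0
    show ?case by (simp add: encode_tuple_def computable_fun_proj)
  next
    case (Suc j)
    then have "computable_fun X (Suc n) (\<lambda>xs. prod_encode (encode_tuple (xs ! 0) (take j (tl xs)), xs ! Suc j))"
      by (intro computable_fun_prod_encode computable_fun_proj) simp_all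
    then show ?case
      by (rule computable_fun_cong)
        (use Suc.prems in \<open>simp add: encode_tuple_def take_Suc_conv_app_nth nth_tl\<close>)
  qed
  from computable_fun_recfn[OF assms[unfolded decidable_def] this[OF order_refl]]
  have "computable_fun X (Suc n) (\<lambda>xs. of_bool (R (encode_tuple (hd xs) (tl xs))))"
    by (rule computable_fun_cong) (auto simp: length_Suc_conv)
  then show ?thesis by (simp add: computable_rel_def computable_fun_def)
qed

lemma decidable_decode_tuple:
  assumes "computable_rel X (Suc n) R"
  shows "decidable X (\<lambda>m. R (decode_tuple n m))"
proof -
  have nth: "recfn X (\<lambda>m. decode_tuple n m ! i)" if "i \<le> n" for i
    using that
  proof (induction n)
    case 0
    then show ?case by (simp add: recfn_id)
  next
    case (Suc n)
    show ?case
    proof (cases "i \<le> n")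
      case True
      with recfn_comp[OF Suc.IH recfn_pfst[OF recfn_id]] show ?thesis by (simp add: nth_append)
    next
      case False
      then have "i = Suc n" using Suc.prems by simp
      then show ?thesis by (simp add: nth_append recfn_psnd recfn_id)
    qed
  qed
  have R: "computable_fun X (Suc n) (\<lambda>xs. of_bool (R xs))"
    using assms by (simp add: computable_rel_def computable_fun_def)
  have "computable_fun X 1 (\<lambda>xs. of_bool (R (map (\<lambda>g. g xs) (map (\<lambda>i xs. decode_tuple n (xs ! 0) ! i) [0..<Suc n]))))"
    by (rule computable_fun_comp) (use R nth in \<open>auto simp: recfn_iff simp del: upt_Suc\<close>)
  moreover have "map (\<lambda>i. decode_tuple n m ! i) [0..<Suc n] = decode_tuple n m" for m
    using map_nth[of "decode_tuple n m"] by simp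
  ultimately show ?thesis
    unfolding decidable_def recfn_iff by (simp add: comp_def del: upt_Suc)
qed

lemma sigma_class_iff: "A \<in> sigma_class n X \<longleftrightarrow> Sig n X (\<lambda>m. m \<in> A)"
proof
  assume "A \<in> sigma_class n X"
  then obtain R where R: "computable_rel X (Suc n) R"
    "\<And>x. x \<in> A \<longleftrightarrow> exists_alt n (\<lambda>ys. R (x # ys))"
    unfolding sigma_class_def by blast
  have "x \<in> A \<longleftrightarrow> exists_alt n (\<lambda>ys. R (decode_tuple n (encode_tuple x ys)))" for x
    unfolding R(2) by (rule exists_alt_cong) (use decode_encode_tuple in auto)
  then show "Sig n X (\<lambda>m. m \<in> A)"
    unfolding Sig_iff_exists_alt using decidable_decode_tuple[OF R(1)] by blast
next
  assume "Sig n X (\<lambda>m. m \<in> A)"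
  then obtain R where R: "decidable X R" "\<And>x. x \<in> A \<longleftrightarrow> exists_alt n (\<lambda>ys. R (encode_tuple x ys))"
    unfolding Sig_iff_exists_alt by blast
  show "A \<in> sigma_class n X"
    unfolding sigma_class_def
    by (intro CollectI exI[of _ "\<lambda>xs. R (encode_tuple (hd xs) (tl xs))"] conjI computable_rel_encode_tuple R(1))
      (simp add: R(2))
qed

lemma computable_rel_not:
  assumes "computable_rel X k R" shows "computable_rel X k (\<lambda>xs. \<not> R xs)"
proof -
  have "computable_fun X k (\<lambda>xs. of_bool (R xs))"
    using assms by (simp add: computable_rel_def computable_fun_def)
  then have "computable_fun X k (\<lambda>xs. 1 - of_bool (R xs))"
    by (intro computable_fun_diff computable_fun_const)
  moreover have "1 - of_bool Q = (of_bool (\<not> Q) :: nat)" for Q by simp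
  ultimately show ?thesis by (simp add: computable_rel_def computable_fun_def)
qed

lemma pi_class_iff: "A \<in> pi_class n X \<longleftrightarrow> - A \<in> sigma_class n X"
proof
  assume "A \<in> pi_class n X"
  then show "- A \<in> sigma_class n X"
    unfolding pi_class_def sigma_class_def
    using computable_rel_not by (auto simp: not_forall_alt) blast
next
  assume "- A \<in> sigma_class n X"
  then obtain R where R: "computable_rel X (Suc n) R" "\<And>x. x \<notin> A \<longleftrightarrow> exists_alt n (\<lambda>ys. R (x # ys))"
    unfolding sigma_class_def by auto
  have "x \<in> A \<longleftrightarrow> forall_alt n (\<lambda>ys. \<not> R (x # ys))" for x
    using R(2)[of x] not_exists_alt[of n "\<lambda>ys. R (x # ys)"] by argo
  then show "A \<in> pi_class n X"
    unfolding pi_class_def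
    by (intro CollectI exI[of _ "\<lambda>xs. \<not> R xs"] conjI computable_rel_not R(1) allI)
qed

fun subst_query :: "prog \<Rightarrow> prog \<Rightarrow> prog" where
  "subst_query q Query = q"
| "subst_query q (Comp f gs) = Comp (subst_query q f) (map (subst_query q) gs)"
| "subst_query q (PrimRec f g) = PrimRec (subst_query q f) (subst_query q g)"
| "subst_query q (Mu f) = Mu (subst_query q f)"
| "subst_query q p = p"

lemma computes_subst_query:
  assumes "\<And>x. computes Y q [x] (of_bool (x \<in> X))"
  shows "computes X p xs y \<Longrightarrow> computes Y (subst_query q p) xs y"
proof (induction rule: computes.induct)
  case (comp xs gs ys f z)
  then have "list_all2 (\<lambda>g y. computes Y g xs y) (map (subst_query q) gs) ys"
    by (auto simp: list_all2_conv_all_nth)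
  then show ?case using comp.IH(2) by (auto intro: computes.comp)
next
  case (mu f n xs)
  then show ?case by (auto intro!: computes.mu)
next
  case (query x)
  show ?case unfolding subst_query.simps by (rule assms)
next
  case (primrec_Suc f g n xs r y)
  then show ?case by (auto intro: computes.primrec_Suc)
qed (simp_all add: computes.intros)

lemma sigma_class_join: "A \<in> sigma_class n Z \<Longrightarrow> A \<in> sigma_class n (Z \<oplus> G)"
proof -
  have "decidable (Z \<oplus> G) (\<lambda>x. 2 * x \<in> Z \<oplus> G)" by (intro recfn_intros)
  then have "decidable (Z \<oplus> G) (\<lambda>x. x \<in> Z)" by (simp add: join_iff)
  then obtain q where "\<And>x. computes (Z \<oplus> G) q [x] (of_bool (x \<in> Z))"
    unfolding decidable_def recfn_def by blast
  then have "computable_rel Z k R \<Longrightarrow> computable_rel (Z \<oplus> G) k R" for k R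
    unfolding computable_rel_def using computes_subst_query by blast
  then show "A \<in> sigma_class n Z \<Longrightarrow> A \<in> sigma_class n (Z \<oplus> G)"
    unfolding sigma_class_def by blast
qed

section \<open>Forcing with \<open>\<Pi>\<^sub>1\<close> classes\<close>

lemma accepts_mono: "accepts s X t \<Longrightarrow> s \<le> s' \<Longrightarrow> accepts s' X t"
  unfolding accepts_def using stage_mono[of s s' X] by (meson less_le_trans subsetD)

lemma accepts_join_cong:
  assumes "G \<inter> {..<s} = H \<inter> {..<s}"
  shows "accepts s (Z \<oplus> G) t \<longleftrightarrow> accepts s (Z \<oplus> H) t"
proof -
  have "x div 2 \<in> G \<longleftrightarrow> x div 2 \<in> H" if "x < s" for x
    using assms that by (metis IntD1 IntI div_le_dividend le_less_trans lessThan_iff)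
  then have "(Z \<oplus> G) \<inter> {..<s} = (Z \<oplus> H) \<inter> {..<s}"
    by (auto simp: join_iff)
  from stage_cong[OF this] show ?thesis unfolding accepts_def by simp
qed

lemma decidable_accepts [recfn_intros]:
  assumes "recfn Z s" "recfn Z g" "recfn Z t"
  shows "decidable Z (\<lambda>x. accepts (s x) (Z \<oplus> set_decode (g x)) (t x))"
  unfolding accepts_def by (intro assms[THEN recfn_comp] assms recfn_intros)

lemma Sig_not: "Sig n X P \<Longrightarrow> Sig (Suc n) X (\<lambda>x. \<not> P x)"
  using Sig_comp[of n X P pfst] by (auto simp: recfn_intros intro!: exI[of _ "\<lambda>z. P (pfst z)"])

lemma less_of_in_set_decode: "t \<in> set_decode c \<Longrightarrow> t < c"
proof -
  assume "t \<in> set_decode c"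
  then have "c div 2 ^ t \<noteq> 0" by (auto simp: set_decode_def intro: ccontr)
  then have "2 ^ t \<le> c" by (metis div_less not_le)
  then show ?thesis by (meson less_exp less_le_trans)
qed

lemma set_encode_less_power:
  assumes "A \<subseteq> {..<s}" shows "set_encode A < 2 ^ s"
proof -
  have "sum ((^) 2) A \<le> (\<Sum>i<s. 2 ^ i :: nat)"
    by (rule sum_mono2) (use assms in auto)
  also have "\<dots> < 2 ^ s" by (induction s) simp_all
  finally show ?thesis by (simp add: set_encode_def)
qed

lemma weak_konig:
  fixes Q :: "nat \<Rightarrow> nat set \<Rightarrow> bool"
  assumes cong: "\<And>s G H. G \<inter> {..<s} = H \<inter> {..<s} \<Longrightarrow> Q s G \<Longrightarrow> Q s H"
    and anti: "\<And>s s' G. s \<le> s' \<Longrightarrow> Q s' G \<Longrightarrow> Q s G"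
    and ex: "\<And>s. \<exists>G. Q s G"
  shows "\<exists>G. \<forall>s. Q s G"
proof -
  define ok where "ok k F \<longleftrightarrow> (\<forall>s. \<exists>G. G \<inter> {..<k} = F \<and> Q s G)" for k F
  have "\<exists>F'. ok (Suc k) F' \<and> F' \<inter> {..<k} = F" if okF: "ok k F" for k F
  proof (rule ccontr)
    assume none: "\<nexists>F'. ok (Suc k) F' \<and> F' \<inter> {..<k} = F"
    have F: "F \<inter> {..<k} = F" using okF unfolding ok_def by auto
    then have "(insert k F) \<inter> {..<k} = F" by auto
    with none F obtain s s' where s: "\<nexists>G. G \<inter> {..<Suc k} = F \<and> Q s G"
      and s': "\<nexists>G. G \<inter> {..<Suc k} = insert k F \<and> Q s' G"
      unfolding ok_def by metis
    obtain G where G: "G \<inter> {..<k} = F" "Q (max s s') G"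
      using okF unfolding ok_def by blast
    have "Q s G" "Q s' G" using anti[OF _ G(2)] by simp_all
    moreover have "G \<inter> {..<Suc k} = (if k \<in> G then insert k F else F)"
      using G(1) by (auto simp: less_Suc_eq)
    ultimately show False using s s' by (cases "k \<in> G") auto
  qed
  moreover have "ok 0 {}" using ex by (simp add: ok_def)
  ultimately obtain F where F: "\<And>k. ok k (F k)" "\<And>k. F (Suc k) \<inter> {..<k} = F k"
    using dependent_nat_choice[of ok "\<lambda>k F F'. F' \<inter> {..<k} = F"] by blast
  have restrict: "F (k + j) \<inter> {..<k} = F k" for k j
  proof (induction j)
    case 0
    show ?case using F(1)[of k] unfolding ok_def by auto
  next
    case (Suc j)
    have "F (k + Suc j) \<inter> {..<k} = F (Suc (k + j)) \<inter> {..<k + j} \<inter> {..<k}" by auto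
    then show ?case using Suc F(2) by simp
  qed
  define G where "G = (\<Union>k. F k)"
  have "G \<inter> {..<k} = F k" for k
  proof -
    have "F j \<inter> {..<k} \<subseteq> F k" for j
    proof (cases "j \<le> k")
      case True
      then show ?thesis using restrict[of j "k - j"] by auto
    next
      case False
      then show ?thesis using restrict[of k "j - k"] by auto
    qed
    moreover have "F k \<subseteq> {..<k}" using restrict[of k 0] by auto
    ultimately show ?thesis unfolding G_def by blast
  qed
  then have "Q s G" for s
    using F(1)[of s] cong unfolding ok_def by metis
  then show ?thesis by blast
qed

lemma string_code_snoc: "string_code (\<sigma> @ [b]) = 2 * string_code \<sigma> + 1 + of_bool b"
  by (simp add: string_code_def)

lemma inj_string_code: "inj string_code"
proof (rule injI)
  fix \<sigma> \<tau> assume "string_code \<sigma> = string_code \<tau>"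
  then show "\<sigma> = \<tau>"
  proof (induction \<sigma> arbitrary: \<tau> rule: rev_induct)
    case Nil
    then show ?case by (cases \<tau> rule: rev_cases) (simp_all add: string_code_snoc, simp add: string_code_def)
  next
    case (snoc b \<sigma>)
    then obtain \<tau>' b' where \<tau>: "\<tau> = \<tau>' @ [b']"
      by (cases \<tau> rule: rev_cases) (simp_all add: string_code_snoc, simp add: string_code_def)
    with snoc.prems have "2 * string_code \<sigma> + of_bool b = 2 * string_code \<tau>' + of_bool b'"
      by (simp add: string_code_snoc)
    then have "string_code \<sigma> = string_code \<tau>' \<and> b = b'"
      by (cases b; cases b'; simp; presburger)
    with snoc.IH \<tau> show ?case by simp
  qed
qed

locale computable_infinite_tree =
  fixes Z :: "nat set" and T :: "bool list set"
  assumes tree: "binary_tree T" and inf: "infinite T" and comp: "computable_tree Z T"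
begin

text \<open>
  A condition is a finite set \<open>C\<close> of pairs of an index and an argument; it stands for the \<open>\<Pi>\<^sub>1\<close> class
  \<open>solutions C\<close> of the paths of \<open>T\<close> relative to which no pair in \<open>C\<close> is ever accepted.
\<close>

definition consistent_at :: "nat \<Rightarrow> nat set \<Rightarrow> nat set \<Rightarrow> bool" where
  "consistent_at s C G \<longleftrightarrow> map (\<lambda>i. i \<in> G) [0..<s] \<in> T \<and> (\<forall>t<s. t \<in> C \<longrightarrow> \<not> accepts s (Z \<oplus> G) t)"

definition consistent :: "nat set \<Rightarrow> bool" where "consistent C \<longleftrightarrow> (\<forall>s. \<exists>G. consistent_at s C G)"

definition solutions :: "nat set \<Rightarrow> nat set set" where "solutions C = {G. \<forall>s. consistent_at s C G}"

lemma solutions_iff: "G \<in> solutions C \<longleftrightarrow> G \<in> paths T \<and> (\<forall>t\<in>C. \<forall>s. \<not> accepts s (Z \<oplus> G) t)"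
proof
  assume G: "G \<in> solutions C"
  have "\<not> accepts s (Z \<oplus> G) t" if "t \<in> C" for s t
    using G accepts_mono[of s _ t "max s (Suc t)"] that unfolding solutions_def consistent_at_def
    by (metis (mono_tags, lifting) less_eq_Suc_le max.cobounded1 max.cobounded2 mem_Collect_eq)
  then show "G \<in> paths T \<and> (\<forall>t\<in>C. \<forall>s. \<not> accepts s (Z \<oplus> G) t)"
    using G by (auto simp: solutions_def consistent_at_def paths_def)
qed (auto simp: solutions_def consistent_at_def paths_def)

lemma consistent_at_antimono: "s \<le> s' \<Longrightarrow> consistent_at s' C G \<Longrightarrow> consistent_at s C G"
proof -
  assume "s \<le> s'" and g: "consistent_at s' C G"
  then have "prefix (map (\<lambda>i. i \<in> G) [0..<s]) (map (\<lambda>i. i \<in> G) [0..<s'])"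
    by (metis le_Suc_ex map_append prefixI upt_add_eq_append zero_le)
  then show "consistent_at s C G"
    using g tree accepts_mono[OF _ \<open>s \<le> s'\<close>] \<open>s \<le> s'\<close>
    unfolding consistent_at_def binary_tree_def by (meson less_le_trans)
qed

lemma consistent_at_cong: "G \<inter> {..<s} = H \<inter> {..<s} \<Longrightarrow> consistent_at s C G \<longleftrightarrow> consistent_at s C H"
proof -
  assume eq: "G \<inter> {..<s} = H \<inter> {..<s}"
  have "i \<in> G \<longleftrightarrow> i \<in> H" if "i < s" for i
    using eq that by blast
  then have "map (\<lambda>i. i \<in> G) [0..<s] = map (\<lambda>i. i \<in> H) [0..<s]" by simp
  then show ?thesis unfolding consistent_at_def accepts_join_cong[OF eq] by (simp only:)
qed

lemma consistent_iff: "consistent C \<longleftrightarrow> solutions C \<noteq> {}"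
proof
  assume "consistent C"
  have "\<exists>G. \<forall>s. consistent_at s C G"
  proof (rule weak_konig)
    show "G \<inter> {..<s} = H \<inter> {..<s} \<Longrightarrow> consistent_at s C G \<Longrightarrow> consistent_at s C H" for s G H
      using consistent_at_cong by blast
    show "\<exists>G. consistent_at s C G" for s
      using \<open>consistent C\<close> unfolding consistent_def by blast
  qed (rule consistent_at_antimono)
  then show "solutions C \<noteq> {}" unfolding solutions_def by blast
qed (auto simp: consistent_def solutions_def)

lemma solutions_Un: "solutions (C \<union> D) = solutions C \<inter> solutions D"
  by (auto simp: solutions_iff)

lemma solutions_antimono: "C \<subseteq> D \<Longrightarrow> solutions D \<subseteq> solutions C"
  unfolding solutions_iff subset_iff by blast

lemma consistent_empty: "consistent {}"
  unfolding consistent_def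
proof
  fix s
  have "\<exists>\<sigma>\<in>T. s \<le> length \<sigma>"
  proof (rule ccontr)
    assume "\<not> ?thesis"
    then have "T \<subseteq> {\<sigma>. set \<sigma> \<subseteq> UNIV \<and> length \<sigma> \<le> s}" by auto
    then show False using inf finite_lists_length_le[of "UNIV :: bool set" s] finite_subset by auto
  qed
  then obtain \<sigma> where "\<sigma> \<in> T" "s \<le> length \<sigma>" by blast
  moreover have "map (\<lambda>i. i \<in> {i. i < s \<and> \<sigma> ! i}) [0..<s] = take s \<sigma>"
    using \<open>s \<le> length \<sigma>\<close> by (auto intro: nth_equalityI)
  ultimately have "consistent_at s {} {i. i < s \<and> \<sigma> ! i}"
    using tree take_is_prefix unfolding consistent_at_def binary_tree_def by auto
  then show "\<exists>G. consistent_at s {} G" ..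
qed

lemma ex_consistent_at_iff: "(\<exists>G. consistent_at s C G) \<longleftrightarrow> (\<exists>g<2 ^ s. consistent_at s C (set_decode g))"
proof
  assume "\<exists>G. consistent_at s C G"
  then obtain G where "consistent_at s C G" ..
  then have "consistent_at s C (set_decode (set_encode (G \<inter> {..<s})))"
    by (subst consistent_at_cong[of _ _ G]) (auto simp: set_encode_inverse)
  then show "\<exists>g<2 ^ s. consistent_at s C (set_decode g)"
    using set_encode_less_power[of "G \<inter> {..<s}" s] by blast
qed blast

lemma decidable_tree [recfn_intros]:
  assumes "recfn Z g" "recfn Z s"
  shows "decidable Z (\<lambda>x. map (\<lambda>i. i \<in> set_decode (g x)) [0..<s x] \<in> T)"
proof -
  have "decidable Z (\<lambda>x. x \<in> string_code ` T)"
    using comp unfolding computable_tree_def computable_set_def decidable_def recfn_def .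
  moreover have "rec_nat 0 (\<lambda>i c. 2 * c + 1 + of_bool (i \<in> A)) n
      = string_code (map (\<lambda>i. i \<in> A) [0..<n])" for A n
    by (induction n) (simp_all add: string_code_snoc, simp add: string_code_def)
  moreover have "recfn Z (\<lambda>x. rec_nat 0 (\<lambda>i c. 2 * c + 1 + of_bool (i \<in> set_decode (g x))) (s x))"
    by (intro assms[THEN recfn_comp] assms recfn_intros)
  ultimately have "decidable Z (\<lambda>x. string_code (map (\<lambda>i. i \<in> set_decode (g x)) [0..<s x]) \<in> string_code ` T)"
    using decidable_comp by simp
  then show ?thesis by (simp add: inj_image_mem_iff[OF inj_string_code])
qed

lemma decidable_consistent_at:
  assumes "recfn Z s" "decidable Z (\<lambda>z. psnd z \<in> C (pfst z))" "recfn Z g"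
  shows "decidable Z (\<lambda>x. consistent_at (s x) (C x) (set_decode (g x)))"
  unfolding consistent_at_def by (intro assms(1,3)[THEN recfn_comp] assms recfn_intros)

text \<open>
  The forcing question. Level \<open>n\<close> is about \<open>\<Sigma>\<^sub>n\<^sub>+\<^sub>1\<close> formulas, and conditions are given by their codes.
  At level \<open>0\<close> a positive answer means that the formula holds for all solutions; at higher levels
  it only means that some extension forces the formula.
\<close>

fun forced :: "nat \<Rightarrow> nat \<Rightarrow> nat \<Rightarrow> nat \<Rightarrow> bool" where
  "forced 0 c e m \<longleftrightarrow> \<not> consistent (insert (prod_encode (e, m)) (set_decode c))"
| "forced (Suc n) c e m \<longleftrightarrow> (\<exists>y c'. set_decode c \<subseteq> set_decode c' \<and> consistent (set_decode c') \<and>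
     \<not> forced n c' e (prod_encode (m, y)))"

lemma Sig_not_consistent:
  assumes "decidable Z (\<lambda>z. psnd z \<in> C (pfst z))"
  shows "Sig (Suc 0) Z (\<lambda>x. \<not> consistent (C x))"
proof -
  have "decidable Z (\<lambda>z. psnd z \<in> C (pfst (pfst z)))"
    using decidable_comp[OF assms, of "\<lambda>z. prod_encode (pfst (pfst z), psnd z)"] by (simp add: recfn_intros)
  then have "decidable Z (\<lambda>z. psnd z \<in> C (pfst (pfst (pfst z))))"
    using decidable_comp[OF assms, of "\<lambda>z. prod_encode (pfst (pfst (pfst z)), psnd z)"] by (simp add: recfn_intros)
  then have "decidable Z (\<lambda>z. \<exists>g<2 ^ psnd z. consistent_at (psnd z) (C (pfst z)) (set_decode g))"
    by (intro decidable_consistent_at recfn_intros)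
  then show ?thesis
    unfolding Sig.simps consistent_def ex_consistent_at_iff by (rule_tac exI[of _ "\<lambda>z. \<exists>g<2 ^ psnd z. consistent_at (psnd z) (C (pfst z)) (set_decode g)"]) simp
qed

lemma Sig_forced: "Sig (Suc n) Z (\<lambda>x. forced n (pfst x) (pfst (psnd x)) (psnd (psnd x)))"
proof (induction n)
  case 0
  show ?case unfolding forced.simps
    by (rule Sig_not_consistent) (simp, intro recfn_intros)
next
  case (Suc n)
  let ?sub = "\<lambda>z. \<forall>t<pfst (pfst z). t \<in> set_decode (pfst (pfst z)) \<longrightarrow> t \<in> set_decode (psnd (psnd z))"
  let ?Q = "\<lambda>z. (\<not> ?sub z \<or> \<not> consistent (set_decode (psnd (psnd z)))) \<or>
      forced n (psnd (psnd z)) (pfst (psnd (pfst z))) (prod_encode (psnd (psnd (pfst z)), pfst (psnd z)))"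
  have "decidable Z (\<lambda>z. \<not> ?sub z)" by (intro recfn_intros)
  then have "Sig (Suc n) Z (\<lambda>z. \<not> ?sub z)"
    using Sig_mono[of 0 "Suc n"] by simp
  moreover have "Sig (Suc 0) Z (\<lambda>z. \<not> consistent (set_decode (psnd (psnd z))))"
    by (rule Sig_not_consistent) (intro recfn_intros)
  then have "Sig (Suc n) Z (\<lambda>z. \<not> consistent (set_decode (psnd (psnd z))))"
    by (rule Sig_mono[rotated]) simp
  moreover have "Sig (Suc n) Z (\<lambda>z. forced n (psnd (psnd z)) (pfst (psnd (pfst z)))
      (prod_encode (psnd (psnd (pfst z)), pfst (psnd z))))"
    using Sig_comp[OF Suc, of "\<lambda>z. prod_encode (psnd (psnd z), prod_encode (pfst (psnd (pfst z)),
      prod_encode (psnd (psnd (pfst z)), pfst (psnd z))))"]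
    by (simp add: recfn_intros)
  ultimately have "Sig (Suc n) Z ?Q"
    using Sig_conj_disj by blast
  moreover have sub: "?sub z \<longleftrightarrow> set_decode (pfst (pfst z)) \<subseteq> set_decode (psnd (psnd z))" for z
    using less_of_in_set_decode by blast
  have "forced (Suc n) (pfst x) (pfst (psnd x)) (psnd (psnd x)) \<longleftrightarrow> (\<exists>y. \<not> ?Q (prod_encode (x, y)))" for x
    unfolding sub forced.simps by simp (metis pfst_prod_encode psnd_prod_encode)
  ultimately show ?case unfolding Sig.simps(2)[of "Suc n"] by blast
qed

definition dense :: "nat set set \<Rightarrow> bool" where
  "dense E \<longleftrightarrow> (\<forall>c. finite c \<and> consistent c \<longrightarrow> (\<exists>d\<in>E. c \<subseteq> d \<and> finite d \<and> consistent d))"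

text \<open>Being comeager refers to the topology generated by the solution classes. Forcing \<open>\<phi>\<close> then means
  that \<open>\<phi>\<close> holds for comeagerly many solutions, and no generic path has to be fixed in advance.\<close>

definition comeager :: "(nat set \<Rightarrow> bool) \<Rightarrow> bool" where
  "comeager \<phi> \<longleftrightarrow> (\<exists>E :: nat \<Rightarrow> nat set set. (\<forall>i. dense (E i)) \<and>
     (\<forall>G\<in>paths T. (\<forall>i. \<exists>d\<in>E i. G \<in> solutions d) \<longrightarrow> \<phi> G))"

definition forces :: "nat set \<Rightarrow> (nat set \<Rightarrow> bool) \<Rightarrow> bool" where
  "forces c \<phi> \<longleftrightarrow> comeager (\<lambda>G. G \<in> solutions c \<longrightarrow> \<phi> G)"

lemma comeager_all:
  fixes \<phi> :: "'i :: countable \<Rightarrow> nat set \<Rightarrow> bool"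
  assumes "\<And>i. comeager (\<phi> i)"
  shows "comeager (\<lambda>G. \<forall>i. \<phi> i G)"
proof -
  obtain E where E: "\<And>i j. dense (E i j)"
    "\<And>i G. G \<in> paths T \<Longrightarrow> (\<And>j :: nat. \<exists>d\<in>E i j. G \<in> solutions d) \<Longrightarrow> \<phi> i G"
    using assms unfolding comeager_def by metis
  let ?E = "\<lambda>k. E (from_nat (pfst k)) (psnd k)"
  have "\<phi> i G" if "G \<in> paths T" "\<And>k. \<exists>d\<in>?E k. G \<in> solutions d" for i G
  proof (rule E(2)[OF that(1)])
    show "\<exists>d\<in>E i j. G \<in> solutions d" for j
      using that(2)[of "prod_encode (to_nat i, j)"] by simp
  qed
  then show ?thesis using E(1) unfolding comeager_def by (intro exI[of _ ?E]) blast
qed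

lemma comeager_mono:
  "comeager \<phi> \<Longrightarrow> (\<And>G. G \<in> paths T \<Longrightarrow> \<phi> G \<Longrightarrow> \<psi> G) \<Longrightarrow> comeager \<psi>"
  unfolding comeager_def by blast

lemma comeager_conj:
  assumes "comeager \<phi>" "comeager \<psi>" shows "comeager (\<lambda>G. \<phi> G \<and> \<psi> G)"
proof -
  have "comeager (\<lambda>G. \<forall>b. (if b then \<phi> else \<psi>) G)"
    by (rule comeager_all) (simp add: assms)
  then show ?thesis by (rule comeager_mono) (metis (full_types))
qed

lemma comeager_dense: "dense E \<Longrightarrow> comeager (\<lambda>G. \<exists>d\<in>E. G \<in> solutions d)"
  unfolding comeager_def by (intro exI[of _ "\<lambda>_. E"]) auto

lemma comeager_True: "(\<And>G. G \<in> paths T \<Longrightarrow> \<phi> G) \<Longrightarrow> comeager \<phi>"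
  unfolding comeager_def dense_def by (intro exI[of _ "\<lambda>_. UNIV"]) auto

lemma forces_mono: "forces c \<phi> \<Longrightarrow> (\<And>G. \<phi> G \<Longrightarrow> \<psi> G) \<Longrightarrow> forces c \<psi>"
  unfolding forces_def by (erule comeager_mono) blast

lemma forces_if_dense:
  assumes "\<And>b. finite b \<Longrightarrow> consistent b \<Longrightarrow> c \<subseteq> b \<Longrightarrow> \<exists>d. b \<subseteq> d \<and> finite d \<and> consistent d \<and> forces d \<phi>"
    and "finite c"
  shows "forces c \<phi>"
proof -
  let ?E = "{d. finite d \<and> (forces d \<phi> \<or> \<not> consistent (d \<union> c))}"
  have "dense ?E"
    unfolding dense_def
  proof (intro allI impI, elim conjE)
    fix b assume b: "finite b" "consistent b"
    show "\<exists>d\<in>?E. b \<subseteq> d \<and> finite d \<and> consistent d"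
    proof (cases "consistent (b \<union> c)")
      case True
      then obtain d where "b \<union> c \<subseteq> d" "finite d" "consistent d" "forces d \<phi>"
        using assms(1)[of "b \<union> c"] assms(2) b(1) by auto
      then show ?thesis by blast
    qed (use b in blast)
  qed
  moreover have "comeager (\<lambda>G. \<forall>k. finite (set_decode k) \<and> forces (set_decode k) \<phi> \<and> G \<in> solutions (set_decode k) \<longrightarrow> \<phi> G)"
  proof (rule comeager_all)
    show "comeager (\<lambda>G. finite (set_decode k) \<and> forces (set_decode k) \<phi> \<and> G \<in> solutions (set_decode k) \<longrightarrow> \<phi> G)" for k
    proof (cases "forces (set_decode k) \<phi>")
      case True
      then show ?thesis unfolding forces_def by (rule comeager_mono) blast
    qed (auto intro: comeager_True)
  qed
  ultimately have "comeager (\<lambda>G. (\<exists>d\<in>?E. G \<in> solutions d) \<and>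
      (\<forall>k. finite (set_decode k) \<and> forces (set_decode k) \<phi> \<and> G \<in> solutions (set_decode k) \<longrightarrow> \<phi> G))"
    by (intro comeager_conj comeager_dense)
  then have "comeager (\<lambda>G. G \<in> solutions c \<longrightarrow> \<phi> G)"
  proof (rule comeager_mono)
    fix G
    assume "(\<exists>d\<in>?E. G \<in> solutions d) \<and>
      (\<forall>k. finite (set_decode k) \<and> forces (set_decode k) \<phi> \<and> G \<in> solutions (set_decode k) \<longrightarrow> \<phi> G)"
    then obtain d where d: "d \<in> ?E" "G \<in> solutions d"
      and all: "\<And>k. finite (set_decode k) \<Longrightarrow> forces (set_decode k) \<phi> \<Longrightarrow> G \<in> solutions (set_decode k) \<Longrightarrow> \<phi> G"
      by blast
    show "G \<in> solutions c \<longrightarrow> \<phi> G"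
    proof
      assume "G \<in> solutions c"
      with d(2) have "consistent (d \<union> c)" by (auto simp: consistent_iff solutions_Un)
      with d(1) have "finite d" "forces d \<phi>" by auto
      then show "\<phi> G" using all[of "set_encode d"] d(2) by (simp add: set_encode_inverse)
    qed
  qed
  then show ?thesis by (simp only: forces_def)
qed

lemma forced_decides:
  assumes "consistent (set_decode c)"
  shows "(forced n c e m \<longrightarrow> (\<exists>d. set_decode c \<subseteq> d \<and> finite d \<and> consistent d \<and>
            forces d (\<lambda>G. universal n (Z \<oplus> G) e m))) \<and>
         (\<not> forced n c e m \<longrightarrow> (\<exists>d. set_decode c \<subseteq> d \<and> finite d \<and> consistent d \<and>
            forces d (\<lambda>G. \<not> universal n (Z \<oplus> G) e m)))"
  using assms
proof (induction n arbitrary: c m)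
  case 0
  show ?case
  proof (intro conjI impI)
    assume "forced 0 c e m"
    then have "G \<notin> solutions (insert (prod_encode (e, m)) (set_decode c))" for G
      by (auto simp: consistent_iff)
    then have "forces (set_decode c) (\<lambda>G. universal 0 (Z \<oplus> G) e m)"
      unfolding forces_def by (intro comeager_True) (auto simp: solutions_iff)
    then show "\<exists>d. set_decode c \<subseteq> d \<and> finite d \<and> consistent d \<and> forces d (\<lambda>G. universal 0 (Z \<oplus> G) e m)"
      using 0 by auto
  next
    assume "\<not> forced 0 c e m"
    moreover have "forces (insert (prod_encode (e, m)) (set_decode c)) (\<lambda>G. \<not> universal 0 (Z \<oplus> G) e m)"
      unfolding forces_def by (intro comeager_True) (auto simp: solutions_iff)
    ultimately show "\<exists>d. set_decode c \<subseteq> d \<and> finite d \<and> consistent d \<and> forces d (\<lambda>G. \<not> universal 0 (Z \<oplus> G) e m)"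
      by (intro exI[of _ "insert (prod_encode (e, m)) (set_decode c)"]) auto
  qed
next
  case (Suc n)
  show ?case
  proof (intro conjI impI)
    assume "forced (Suc n) c e m"
    then obtain y c' where c': "set_decode c \<subseteq> set_decode c'" "consistent (set_decode c')"
      "\<not> forced n c' e (prod_encode (m, y))" by auto
    then obtain d where "set_decode c' \<subseteq> d" "finite d" "consistent d"
      "forces d (\<lambda>G. \<not> universal n (Z \<oplus> G) e (prod_encode (m, y)))"
      using Suc.IH[OF c'(2), of "prod_encode (m, y)"] by blast
    moreover from this have "forces d (\<lambda>G. universal (Suc n) (Z \<oplus> G) e m)"
      by (elim forces_mono) auto
    ultimately show "\<exists>d. set_decode c \<subseteq> d \<and> finite d \<and> consistent d \<and>
        forces d (\<lambda>G. universal (Suc n) (Z \<oplus> G) e m)"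
      using c'(1) by blast
  next
    assume not_forced: "\<not> forced (Suc n) c e m"
    have "forces (set_decode c) (\<lambda>G. universal n (Z \<oplus> G) e (prod_encode (m, y)))" for y
    proof (rule forces_if_dense)
      fix b assume b: "finite b" "consistent b" "set_decode c \<subseteq> b"
      then have "forced n (set_encode b) e (prod_encode (m, y))"
        using not_forced by (auto simp: set_encode_inverse)
      then show "\<exists>d. b \<subseteq> d \<and> finite d \<and> consistent d \<and>
          forces d (\<lambda>G. universal n (Z \<oplus> G) e (prod_encode (m, y)))"
        using Suc.IH[of "set_encode b" "prod_encode (m, y)"] b by (simp add: set_encode_inverse)
    qed simp
    then have "comeager (\<lambda>G. \<forall>y. G \<in> solutions (set_decode c) \<longrightarrow> universal n (Z \<oplus> G) e (prod_encode (m, y)))"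
      unfolding forces_def by (rule comeager_all)
    then have "forces (set_decode c) (\<lambda>G. \<not> universal (Suc n) (Z \<oplus> G) e m)"
      unfolding forces_def by (rule comeager_mono) auto
    then show "\<exists>d. set_decode c \<subseteq> d \<and> finite d \<and> consistent d \<and>
        forces d (\<lambda>G. \<not> universal (Suc n) (Z \<oplus> G) e m)"
      using Suc.prems by auto
  qed
qed

lemma comeager_differs:
  assumes "\<not> Sig (Suc n) Z P"
  shows "comeager (\<lambda>G. \<exists>m. P m \<noteq> universal n (Z \<oplus> G) e m)"
proof -
  have "forces {} (\<lambda>G. \<exists>m. P m \<noteq> universal n (Z \<oplus> G) e m)"
  proof (rule forces_if_dense)
    fix b assume b: "finite b" "consistent b"
    define c where "c = set_encode b"
    have c: "set_decode c = b" using b(1) by (simp add: c_def set_encode_inverse)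
    have "Sig (Suc n) Z (\<lambda>m. forced n c e m)"
      using Sig_comp[OF Sig_forced, of "\<lambda>m. prod_encode (c, prod_encode (e, m))" n]
      by (simp add: recfn_intros del: Sig.simps)
    with assms have "P \<noteq> forced n c e" by metis
    then obtain m where "P m \<noteq> forced n c e m" by blast
    with forced_decides[of c n e m] c b
    obtain d where "b \<subseteq> d" "finite d" "consistent d" "forces d (\<lambda>G. universal n (Z \<oplus> G) e m \<longleftrightarrow> \<not> P m)"
      by (cases "P m") auto
    moreover from this have "forces d (\<lambda>G. \<exists>m. P m \<noteq> universal n (Z \<oplus> G) e m)"
      by (elim forces_mono) blast
    ultimately show "\<exists>d. b \<subseteq> d \<and> finite d \<and> consistent d \<and> forces d (\<lambda>G. \<exists>m. P m \<noteq> universal n (Z \<oplus> G) e m)"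
      by blast
  qed simp
  then show ?thesis
    unfolding forces_def by (rule comeager_mono) (simp add: solutions_iff)
qed

lemma comeager_ex:
  assumes "comeager \<phi>" shows "\<exists>G\<in>paths T. \<phi> G"
proof -
  obtain E where E: "\<And>i. dense (E i)"
    "\<And>G. G \<in> paths T \<Longrightarrow> (\<And>i :: nat. \<exists>d\<in>E i. G \<in> solutions d) \<Longrightarrow> \<phi> G"
    using assms unfolding comeager_def by metis
  have "\<exists>d. (finite d \<and> consistent d) \<and> c \<subseteq> d \<and> d \<in> E i" if "finite c \<and> consistent c" for c i
    using E(1)[of i] that unfolding dense_def by blast
  then have "\<exists>C. \<forall>i. (finite (C i) \<and> consistent (C i)) \<and> C i \<subseteq> C (Suc i) \<and> C (Suc i) \<in> E i"
    using consistent_empty by (intro dependent_nat_choice) (blast intro: finite.emptyI)+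
  then obtain C where C: "\<And>i. finite (C i) \<and> consistent (C i)" "\<And>i. C i \<subseteq> C (Suc i) \<and> C (Suc i) \<in> E i"
    by metis
  have mono: "i \<le> j \<Longrightarrow> C i \<subseteq> C j" for i j
    by (rule lift_Suc_mono_le[of C]) (use C(2) in auto)
  have "\<exists>i. (\<Union>i. C i) \<inter> {..<s} \<subseteq> C i" for s
  proof (induction s)
    case (Suc s)
    then obtain i where i: "(\<Union>i. C i) \<inter> {..<s} \<subseteq> C i" ..
    show ?case
    proof (cases "s \<in> (\<Union>i. C i)")
      case True
      then obtain j where "s \<in> C j" by blast
      moreover have "(\<Union>i. C i) \<inter> {..<Suc s} \<subseteq> insert s ((\<Union>i. C i) \<inter> {..<s})"
        by (auto simp: less_Suc_eq)
      ultimately have "(\<Union>i. C i) \<inter> {..<Suc s} \<subseteq> C (max i j)"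
        using i mono[of i "max i j", OF max.cobounded1] mono[of j "max i j", OF max.cobounded2] by blast
      then show ?thesis ..
    next
      case False
      then have "(\<Union>i. C i) \<inter> {..<Suc s} = (\<Union>i. C i) \<inter> {..<s}"
        by (auto simp: less_Suc_eq)
      then show ?thesis using i by metis
    qed
  qed simp
  then have "\<exists>G. consistent_at s (\<Union>i. C i) G" for s
    using C(1) unfolding consistent_def consistent_at_def by (meson Int_iff lessThan_iff subsetD)
  then obtain G where G: "G \<in> solutions (\<Union>i. C i)"
    using consistent_iff unfolding consistent_def by blast
  then have "G \<in> solutions (C i)" for i
    using solutions_antimono[of "C i" "\<Union>i. C i"] by auto
  then have "\<exists>d\<in>E i. G \<in> solutions d" for i
    using C(2) by blast
  moreover have "G \<in> paths T" using G by (simp add: solutions_iff)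
  ultimately show ?thesis using E(2) by blast
qed

lemma ex_path_preserving_not_sigma:
  "\<exists>G\<in>paths T. \<forall>A k n. A \<in> sigma_class k Z \<longrightarrow> A \<notin> sigma_class (Suc n) Z \<longrightarrow>
     A \<notin> sigma_class (Suc n) (Z \<oplus> G)"
proof -
  let ?R = "\<lambda>(k, a, n, e) G. \<not> Sig (Suc n) Z (universal k Z a) \<longrightarrow> (\<exists>m. universal k Z a m \<noteq> universal n (Z \<oplus> G) e m)"
  have "comeager (?R i)" for i
  proof -
    obtain k a n e where i: "i = (k, a, n, e)" by (cases i) auto
    show ?thesis
    proof (cases "Sig (Suc n) Z (universal k Z a)")
      case True
      then show ?thesis unfolding i by (intro comeager_True) (simp del: Sig.simps)
    next
      case False
      show ?thesis
        unfolding i by (rule comeager_mono[OF comeager_differs[OF False, of e]]) (simp del: Sig.simps)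
    qed
  qed
  then have "comeager (\<lambda>G. \<forall>i. ?R i G)" by (rule comeager_all)
  from comeager_ex[OF this] obtain G where G: "G \<in> paths T" and R: "\<forall>i. ?R i G" by blast
  have differs: "\<exists>m. universal k Z a m \<noteq> universal n (Z \<oplus> G) e m" if "\<not> Sig (Suc n) Z (universal k Z a)" for k a n e
    using spec[OF R, of "(k, a, n, e)"] that by (simp del: Sig.simps)
  show ?thesis
  proof (intro bexI[OF _ G] allI impI notI)
    fix A k n
    assume A: "A \<in> sigma_class k Z" "A \<notin> sigma_class (Suc n) Z" "A \<in> sigma_class (Suc n) (Z \<oplus> G)"
    from Sig_universal[OF Sig_Suc[OF A(1)[unfolded sigma_class_iff]]]
    obtain a where "\<forall>m. m \<in> A \<longleftrightarrow> universal k Z a m" ..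
    then have a: "(\<lambda>m. m \<in> A) = universal k Z a" by blast
    from Sig_universal[OF A(3)[unfolded sigma_class_iff]]
    obtain e where "\<forall>m. m \<in> A \<longleftrightarrow> universal n (Z \<oplus> G) e m" ..
    then have "(\<lambda>m. m \<in> A) = universal n (Z \<oplus> G) e" by blast
    then show False using differs[of n k a e] A(2) a unfolding sigma_class_iff by simp
  qed
qed

end

lemma sigma_class_compl: "A \<in> sigma_class n Z \<Longrightarrow> - A \<in> sigma_class (Suc n) Z"
  unfolding sigma_class_iff using Sig_not by (simp del: Sig.simps)

lemma pi_class_join: "A \<in> pi_class n Z \<Longrightarrow> A \<in> pi_class n (Z \<oplus> G)"
  unfolding pi_class_iff by (rule sigma_class_join)

theorem theorem3p6:
  fixes Z :: "nat set" and T :: "bool list set"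
  assumes "binary_tree T" and "infinite T" and "computable_tree Z T"
  shows "\<exists>G \<in> paths T. preserves_arithmetic_hierarchy Z G"
proof -
  interpret computable_infinite_tree Z T using assms by unfold_locales
  obtain G where G: "G \<in> paths T" and not_sigma: "\<And>A k n. A \<in> sigma_class k Z \<Longrightarrow>
      A \<notin> sigma_class (Suc n) Z \<Longrightarrow> A \<notin> sigma_class (Suc n) (Z \<oplus> G)"
    using ex_path_preserving_not_sigma by blast
  have not_pi: "A \<notin> pi_class (Suc n) (Z \<oplus> G)"
    if "A \<in> sigma_class k Z" "A \<notin> pi_class (Suc n) Z" for A k n
    using that not_sigma[OF sigma_class_compl] unfolding pi_class_iff by blast
  have arith: "A \<in> sigma_class (Suc n) Z" if "A \<in> pi_class n Z" for A n
    using that sigma_class_compl[of "- A"] unfolding pi_class_iff by simp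
  have "preserves_definitions (properly_sigma (Suc n)) Z G
      \<and> preserves_definitions (properly_pi (Suc n)) Z G
      \<and> preserves_definitions (properly_delta (Suc (Suc n))) Z G" for n
    unfolding preserves_definitions_def properly_sigma_def properly_pi_def properly_delta_def delta_class_def
    using not_sigma not_sigma[OF arith] not_pi sigma_class_join pi_class_join by auto
  then have "preserves_arithmetic_hierarchy Z G"
    unfolding preserves_arithmetic_hierarchy_def by (metis gr0_implies_Suc)
  with G show ?thesis by blast
qed

end
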